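(* Let $q$ be a prime power, $F=GF(q^2)$, $\overline{c}=c^q$ for $c\in F$, and $F_0=\{r\in F: r^q=r\}$ the subfield of order $q$; write $K^\times$ for the group of units of a field $K$. Let $V=F^3$ with the Hermitian form $B(x,y)=x_1\overline{y_2}+x_2\overline{y_1}+x_3\overline{y_3}$, let $U(3,q^2)$ be the group of $F$-linear automorphisms $\sigma$ of $V$ with $B(\sigma(x),\sigma(y))=B(x,y)$ for all $x,y$, and let $\mathbb{P}C$ be the set of isotropic lines $[x]$ ($x\neq 0$, $B(x,x)=0$). Fix a basis $u,v,w$ of $V$ with $B(u,v)=1=B(w,w)$, $B(u,u)=B(v,v)=0$ and $B(u,w)=B(v,w)=0$. Fix a nonzero $a\in F$ with $a+\overline{a}=0$; let $b_5,\dots,b_{q+4}$ be a complete set of representatives of those cosets of $F_0^\times$ in $F^\times$ which are not contained in $\{x\in F: x+\overline{x}=0\}$, and for each $i\in\{5,\dots,q+4\}$ fix $c_i\in F$ with $b_i+\overline{b_i}+c_i\overline{c_i}=0$. Let $U(3,q^2)$ act on $\mathbb{P}C^3$ by $([x],[y],[z])\mapsto([\sigma(x)],[\sigma(y)],[\sigma(z)])$. The orbits of this action form an association scheme on triples $X=\{R_0,\dots,R_{q+4}\}$ on $\mathbb{P}C$, where $R_0=\{(x,x,x)\}$, $R_1=\{(y,x,x): x\neq y\}$, $R_2=\{(x,y,x):x\neq y\}$, $R_3=\{(x,x,y):x\neq y\}$, $R_4$ is the orbit of $([u],[v],[au+v])$, and for $5\le i\le q+4$, $R_i$ is the orbit of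 $([u],[v],[b_iu+v+c_iw])$. For indices $i,j,k,\ell$ and any $(x,y,z)\in R_\ell$ let $$p_{ijk}^{\ell}=\left|\{\omega\in\mathbb{P}C:(\omega,y,z)\in R_i,\ (x,\omega,z)\in R_j,\ (x,y,\omega)\in R_k\}\right|$$ (independent of the choice of $(x,y,z)\in R_\ell$). Let $H=U(3,q^2)_{[u],[v]}$ denote the stabilizer of both $[u]$ and $[v]$. Then for all $5\le i,j,k,\ell\le q+4$: 1. $p_{144}^{1}=p_{424}^{2}=p_{443}^{3}=q-1$. 2. $p_{14i}^{1}=p_{1i4}^{1}=p_{42i}^{2}=p_{i24}^{2}=p_{4i3}^{3}=p_{i43}^{3}=0$. 3. $p_{1ji}^{1}=q^2-1$ if $R_j$ is the orbit of $([u],[v],[\overline{b_i}u+v+c_iw])$, and $p_{1ji}^1=0$ otherwise. 4. $p_{j2i}^{2}=q^2-1$ if $R_j$ is the orbit of $([u],[v],[b_i^{-1}u+v+(b_i^{-1}c_i)w])$, and $0$ otherwise. 5. $p_{ji3}^{3}=q^2-1$ if the $H$-orbit of $[\overline{b_i}u+v+c_iw]$ equals the $H$-orbit of $[\overline{b_j^{-1}}u+v+(b_j^{-1}c_j)w]$, and $0$ otherwise. 6. $p_{444}^{4}=q-2$. 7. $p_{i44}^{4}=p_{4j4}^{4}=p_{44k}^{4}=p_{ij4}^{4}=p_{i4k}^{4}=p_{4jk}^{4}=0$. 8. $p_{ijk}^{4}=q+1$ if there exist $b,c\in F$ with $([u],[v],[bu+v+cw])\in R_k$ such that $b_j(\overline{b}+a)^{-1}\in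 F_0^\times$ and $b_ib(\overline{b}+a)a^{-1}\in F_0^\times$; otherwise $p_{ijk}^4=0$. 9. $p_{i44}^{\ell}=p_{4j4}^{\ell}=p_{44k}^{\ell}=p_{444}^{\ell}=0$. 10. $p_{4jk}^{\ell}=1$ if there exist $b,c\in F$ with $([u],[v],[bu+v+cw])\in R_k$ such that $b_j(\overline{b}+b_\ell+\overline{c}c_\ell)^{-1}\in F_0^\times$ and $b_\ell c=bc_\ell$; otherwise $p_{4jk}^\ell=0$. 11. $p_{i4k}^{\ell}=1$ if there exist $b,c\in F$ with $([u],[v],[bu+v+cw])\in R_k$ such that $b_ibb_\ell^{-1}(\overline{b}+b_\ell+\overline{c}c_\ell)\in F_0^\times$ and $c=c_\ell$; otherwise $p_{i4k}^\ell=0$. 12. $p_{ij4}^{\ell}=1$ if there exists $g\in F$ with $([u],[v],[gu+v])\in R_4$ such that $b_i(\overline{g}+b_\ell)gb_\ell^{-1}\in F_0^\times$ and $b_j(\overline{g}+b_\ell)^{-1}\in F_0^\times$; otherwise $p_{ij4}^\ell=0$. 13. $p_{ijk}^{\ell}$ equals the number of triples $([u],[v],[bu+v+cw])\in R_k$ (with $b,c\in F$) such that $b_ibb_\ell^{-1}(\overline{b}+b_\ell+\overline{c}c_\ell)\in F_0^\times$ and $b_j(\overline{b}+b_\ell+\overline{c}c_\ell)^{-1}\in F_0^\times$.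
   Context: An association scheme on triples (AST) on a finite set $\Omega$ with $|\Omega|\ge 3$ is a partition $\{R_0,\dots,R_m\}$ ($m\ge 4$) of $\Omega^3$ such that: for each $i$ the number $|\{\omega:(x,y,\omega)\in R_i\}|$ is the same for all distinct $x,y$; the numbers $p_{ijk}^\ell$ defined in the claim are well defined; each $R_i$ is mapped to some $R_j$ by any coordinate permutation; and $R_0,\dots,R_3$ are the trivial relations listed in the claim. The action of $U(3,q^2)$ on $\mathbb{P}C$ is $\sigma[x]=[\sigma(x)]$; it is 2-transitive. *)

theory Defs
  imports "HOL-Analysis.Analysis" "HOL-Number_Theory.Prime_Powers"
begin

section \<open>Association schemes on triples\<close>

fun coord :: "'p \<times> 'p \<times> 'p \<Rightarrow> nat \<Rightarrow> 'p" where
  "coord (x, y, z) n = (if n = 0 then x else if n = 1 then y else z)"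

definition permute_triple :: "(nat \<Rightarrow> nat) \<Rightarrow> 'p \<times> 'p \<times> 'p \<Rightarrow> 'p \<times> 'p \<times> 'p" where
  "permute_triple \<pi> t = (coord t (\<pi> 0), coord t (\<pi> 1), coord t (\<pi> 2))"

definition triple_count ::
  "'p set \<Rightarrow> (nat \<Rightarrow> ('p \<times> 'p \<times> 'p) set) \<Rightarrow> nat \<Rightarrow> nat \<Rightarrow> nat \<Rightarrow> 'p \<Rightarrow> 'p \<Rightarrow> 'p \<Rightarrow> nat" where
  "triple_count \<Omega> R i j k x y z =
     card {\<omega> \<in> \<Omega>. (\<omega>, y, z) \<in> R i \<and> (x, \<omega>, z) \<in> R j \<and> (x, y, \<omega>) \<in> R k}"

text \<open>The index \<open>l\<close> is the superscript: \<open>inum \<Omega> R i j k l\<close> is $p_{ijk}^{l}$. The description operator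
  is only meaningful when the count does not depend on the triple chosen in \<open>R l\<close> and \<open>R l\<close> is
  nonempty; both are part of \<open>AST\<close> below.\<close>

definition inum ::
  "'p set \<Rightarrow> (nat \<Rightarrow> ('p \<times> 'p \<times> 'p) set) \<Rightarrow> nat \<Rightarrow> nat \<Rightarrow> nat \<Rightarrow> nat \<Rightarrow> nat" where
  "inum \<Omega> R i j k l = (THE n. \<forall>(x, y, z) \<in> R l. triple_count \<Omega> R i j k x y z = n)"

text \<open>The scheme consists of the relations \<open>R 0, \<dots>, R m\<close>; values of \<open>R\<close> beyond \<open>m\<close> are irrelevant.\<close>

definition AST :: "'p set \<Rightarrow> nat \<Rightarrow> (nat \<Rightarrow> ('p \<times> 'p \<times> 'p) set) \<Rightarrow> bool" where
  "AST \<Omega> m R \<longleftrightarrow>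
     finite \<Omega> \<and> card \<Omega> \<ge> 3 \<and> m \<ge> 4 \<and>
     inj_on R {0..m} \<and> partition_on (\<Omega> \<times> \<Omega> \<times> \<Omega>) (R ` {0..m}) \<and>
     (\<forall>i\<in>{0..m}. \<exists>n. \<forall>x\<in>\<Omega>. \<forall>y\<in>\<Omega>. x \<noteq> y \<longrightarrow> card {\<omega> \<in> \<Omega>. (x, y, \<omega>) \<in> R i} = n) \<and>
     (\<forall>i\<in>{0..m}. \<forall>j\<in>{0..m}. \<forall>k\<in>{0..m}. \<forall>l\<in>{0..m}.
        \<exists>n. \<forall>(x, y, z) \<in> R l. triple_count \<Omega> R i j k x y z = n) \<and>
     (\<forall>i\<in>{0..m}. \<forall>\<pi>. \<pi> permutes {0, 1, 2} \<longrightarrow> (\<exists>j\<in>{0..m}. permute_triple \<pi> ` R i = R j)) \<and>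
     R 0 = {(x, x, x) | x. x \<in> \<Omega>} \<and>
     R 1 = {(y, x, x) | x y. x \<in> \<Omega> \<and> y \<in> \<Omega> \<and> x \<noteq> y} \<and>
     R 2 = {(x, y, x) | x y. x \<in> \<Omega> \<and> y \<in> \<Omega> \<and> x \<noteq> y} \<and>
     R 3 = {(x, x, y) | x y. x \<in> \<Omega> \<and> y \<in> \<Omega> \<and> x \<noteq> y}"

section \<open>The unitary group and its action on isotropic lines\<close>

text \<open>The field $GF(q^2)$ is a finite field type of cardinality $q^2$.\<close>

abbreviation bar :: "nat \<Rightarrow> 'a::field \<Rightarrow> 'a" where
  "bar q x \<equiv> x ^ q"

definition F0_units :: "nat \<Rightarrow> 'a::field set" where
  "F0_units q = {r. r ^ q = r \<and> r \<noteq> 0}"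

definition F0_coset :: "nat \<Rightarrow> 'a::field \<Rightarrow> 'a set" where
  "F0_coset q x = (\<lambda>r. r * x) ` F0_units q"

definition herm :: "nat \<Rightarrow> 'a::field ^ 3 \<Rightarrow> 'a ^ 3 \<Rightarrow> 'a" where
  "herm q x y = x $ 1 * bar q (y $ 2) + x $ 2 * bar q (y $ 1) + x $ 3 * bar q (y $ 3)"

definition U3 :: "nat \<Rightarrow> ('a::field ^ 3 \<Rightarrow> 'a ^ 3) set" where
  "U3 q = {\<sigma>. Vector_Spaces.linear (*s) (*s) \<sigma> \<and> bij \<sigma> \<and>
              (\<forall>x y. herm q (\<sigma> x) (\<sigma> y) = herm q x y)}"

definition line :: "'a::field ^ 3 \<Rightarrow> ('a ^ 3) set" where
  "line x = vec.span {x}"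

definition PC :: "nat \<Rightarrow> ('a::field ^ 3) set set" where
  "PC q = {line x | x. x \<noteq> 0 \<and> herm q x x = 0}"

text \<open>A linear map acts on lines (as sets of vectors) by taking images, and this is
  $\sigma[x] = [\sigma(x)]$:\<close>

lemma image_line:
  assumes "Vector_Spaces.linear (*s) (*s) \<sigma>"
  shows "\<sigma> ` line x = line (\<sigma> x)"
  using vec.linear_span_image[OF assms, of "{x}"] by (simp add: line_def)

definition act3 ::
  "('v \<Rightarrow> 'v) \<Rightarrow> 'v set \<times> 'v set \<times> 'v set \<Rightarrow> 'v set \<times> 'v set \<times> 'v set" where
  "act3 \<sigma> = (\<lambda>(P, Q, S). (\<sigma> ` P, \<sigma> ` Q, \<sigma> ` S))"

definition orbit3 ::
  "nat \<Rightarrow> ('a::field ^ 3) set \<times> ('a ^ 3) set \<times> ('a ^ 3) set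
    \<Rightarrow> (('a ^ 3) set \<times> ('a ^ 3) set \<times> ('a ^ 3) set) set" where
  "orbit3 q T = {act3 \<sigma> T | \<sigma>. \<sigma> \<in> U3 q}"

definition stab2 ::
  "nat \<Rightarrow> ('a::field ^ 3) set \<Rightarrow> ('a ^ 3) set \<Rightarrow> ('a ^ 3 \<Rightarrow> 'a ^ 3) set" where
  "stab2 q P Q = {\<sigma> \<in> U3 q. \<sigma> ` P = P \<and> \<sigma> ` Q = Q}"

definition line_orbit :: "('v \<Rightarrow> 'v) set \<Rightarrow> 'v set \<Rightarrow> 'v set set" where
  "line_orbit G P = {\<sigma> ` P | \<sigma>. \<sigma> \<in> G}"

end

theory Submission
  imports Defs
begin

text \<open>
  For isotropic vectors \<open>x\<close>, \<open>y\<close>, \<open>z\<close> the product \<open>B(y,x) B(z,y) B(x,z)\<close> is invariant under the unitary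
  group, and rescaling the vectors multiplies it by a norm, that is, by an element of $F_0^\times$.
  Its class in $F^\times / F_0^\times$ therefore depends only on the orbit of the triple of lines, and
  it is a complete invariant for triples of distinct lines: two isotropic vectors with \<open>B(x,y) = 1\<close>
  extend to a hyperbolic basis, which moves the triple to \<open>([u], [v], [\<beta>u + v + \<gamma>w])\<close> with
  invariant \<open>\<beta>\<close>, and diagonal maps realise all changes of \<open>(\<beta>, \<gamma>)\<close> inside one class.

  Every intersection number thus counts pairs \<open>(\<beta>, \<gamma>)\<close> with \<open>\<beta> + \<beta>\<^sup>q + \<gamma>\<^bsup>q+1\<^esup> = 0\<close> for which three
  elements lie in prescribed classes. The trace of each of these elements is the negative of a norm,
  and the class of trace zero (index 4) is recognised by the vanishing of that norm. Since \<open>F\<close> is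
  two-dimensional over $F_0$, an element has at most one decomposition into summands from two
  given distinct classes, which yields the counts \<open>0\<close>, \<open>1\<close> and \<open>q + 1\<close>.
\<close>

section \<open>Finite fields with an involution\<close>

text \<open>Geometry behind the vanishing norms: for isotropic vectors \<open>x\<close>,
  \<open>y\<close>, \<open>z\<close> the trace of the triple product is their Gram determinant,
  which is the negative of the norm of det(x, y, z). Index 4 therefore marks the triples of distinct
  isotropic lines lying in one plane, and such a plane carries q + 1 isotropic lines. With
  superscript 4 the base triple is coplanar, so a further line is coplanar with one pair exactly if
  it is with every pair; the constants q - 1 and q - 2 are q + 1 minus the two or three base lines.
  With a larger superscript the base triple spans the space and two of the planes through its pairs
  meet only in a base line, so of three lower indices from 4 on at most one is 4, and that one
  imposes a linear equation on \<open>(\<beta>, \<gamma>)\<close>. The arithmetic input is that the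
  norm maps the units of \<open>F\<close> onto those of the fixed field with all fibres of size q +
  1: this makes the diagonal maps available and puts q + 1 points over each \<beta> of nonzero
  trace.\<close>

lemma finite_field_power_card:
  fixes x :: "'a::{field, finite}"
  shows "x ^ CARD('a) = x"
proof (cases "x = 0")
  case True
  then show ?thesis using zero_less_card_finite[where ?'a = 'a] by (simp only: zero_power)
next
  case False
  define S where "S = UNIV - {0::'a}"
  \<comment> \<open>Multiplication by \<open>x\<close> permutes the nonzero elements; comparing
    their products and cancelling gives \<open>x ^ card S = 1\<close>.\<close>
  have "bij_betw (\<lambda>y. x * y) S S"
    by (rule bij_betwI[of _ _ _ "\<lambda>y. y / x"]) (use False in \<open>auto simp: S_def\<close>)
  then have "(\<Prod>y\<in>S. x * y) = (\<Prod>y\<in>S. y)"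
    by (rule prod.reindex_bij_betw)
  then have "x ^ card S * (\<Prod>y\<in>S. y) = (\<Prod>y\<in>S. y)"
    by (simp only: prod.distrib prod_constant)
  moreover have "(\<Prod>y\<in>S. y) \<noteq> 0" by (simp add: S_def)
  ultimately have "x ^ card S = 1" by (metis mult_cancel_right1)
  moreover have "CARD('a) = Suc (card S)"
    unfolding S_def by (rule card.remove) auto
  ultimately show ?thesis by (simp only: power_Suc mult_1_right)
qed

text \<open>Pigeonhole: \<open>m * n\<close> elements fit into at most \<open>m\<close> fibres of
  size at most \<open>n\<close> only if both bounds are attained. For trace and norm the bounds come
  from counting polynomial roots.\<close>

lemma card_eq_of_fibres_le:
  assumes fin: "finite T" and map: "\<And>x. x \<in> S \<Longrightarrow> f x \<in> T" and T: "card T \<le> m"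
    and le: "\<And>t. t \<in> T \<Longrightarrow> card {x \<in> S. f x = t} \<le> n"
    and S: "card S = m * n" "S \<noteq> {}" "finite S"
  shows "card T = m" and "\<And>t. t \<in> T \<Longrightarrow> card {x \<in> S. f x = t} = n"
proof -
  have "S = (\<Union>t\<in>T. {x \<in> S. f x = t})" using map by auto
  then have "card S = (\<Sum>t\<in>T. card {x \<in> S. f x = t})"
    using fin S(3) by (subst card_UN_disjoint[symmetric]) auto
  then have sum: "m * n = (\<Sum>t\<in>T. card {x \<in> S. f x = t})" using S by simp
  also have "\<dots> \<le> card T * n" using sum_mono[OF le] by simp
  finally have "m * n \<le> card T * n" .
  moreover have "n > 0" using S by (cases n) auto
  ultimately show card: "card T = m" using T by simp
  show "card {x \<in> S. f x = t} = n" if t: "t \<in> T" for t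
  proof (rule ccontr)
    assume "card {x \<in> S. f x = t} \<noteq> n"
    then have "card {x \<in> S. f x = t} < n" using le[OF t] by simp
    then have "(\<Sum>t\<in>T. card {x \<in> S. f x = t}) < (\<Sum>t\<in>T. n)"
      using le t by (intro sum_strict_mono_ex1 fin) auto
    then show False using sum card by simp
  qed
qed

text \<open>Translation by 1 permutes the field, so the sum of all elements does not change and
  \<open>CARD('a)\<close> copies of 1 add up to zero.\<close>

lemma CHAR_dvd_card_UNIV: "CHAR('a::{field, finite}) dvd CARD('a)"
proof -
  have "bij_betw (\<lambda>x::'a. x + 1) UNIV UNIV"
    by (rule bij_betwI[of _ _ _ "\<lambda>x. x - 1"]) auto
  then have "(\<Sum>x\<in>UNIV. x + 1) = (\<Sum>x\<in>UNIV. x :: 'a)"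
    by (rule sum.reindex_bij_betw)
  then have "of_nat CARD('a) = (0::'a)" by (simp only: sum.distrib sum_constant) simp
  then show ?thesis by (simp only: of_nat_eq_0_iff_char_dvd)
qed

section \<open>Conjugation, trace and norm\<close>

locale quadratic_field =
  fixes q :: nat and cj :: "'a::{field, finite} \<Rightarrow> 'a"
  assumes q: "primepow q"
    and card_F: "CARD('a) = q ^ 2"
    and cj_eq: "cj x = x ^ q"
begin

lemma q_gt_1: "1 < q"
  using primepow_gt_Suc_0[OF q] by simp

lemma cj_0 [simp]: "cj 0 = 0" and cj_1 [simp]: "cj 1 = 1"
  using q_gt_1 by (auto simp: cj_eq)

lemma cj_mult [simp]: "cj (x * y) = cj x * cj y"
  by (simp add: cj_eq power_mult_distrib)

lemma cj_inverse [simp]: "cj (inverse x) = inverse (cj x)"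
  by (simp add: cj_eq power_inverse)

lemma cj_divide [simp]: "cj (x / y) = cj x / cj y"
  by (simp add: cj_eq power_divide)

lemma cj_cj [simp]: "cj (cj x) = x"
  using finite_field_power_card[of x] by (simp add: cj_eq card_F power2_eq_square power_mult)

lemma cj_eq_0_iff [simp]: "cj x = 0 \<longleftrightarrow> x = 0"
  using q_gt_1 by (simp add: cj_eq)

text \<open>The prime underlying \<open>q\<close> is the characteristic, because the latter divides
  \<open>CARD('a)\<close>; thus \<open>cj\<close> is an iterate of the Frobenius map.\<close>

lemma cj_add [simp]: "cj (x + y) = cj x + cj y"
proof -
  obtain r n where r: "prime r" "n > 0" "q = r ^ n"
    using q by (auto simp: primepow_def)
  have P: "prime CHAR('a)"
    by (rule prime_CHAR_semidom) (simp add: finite_imp_CHAR_pos)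
  have "CHAR('a) dvd r ^ (n * 2)"
    using CHAR_dvd_card_UNIV[where ?'a = 'a] by (simp add: card_F r power_mult)
  then have "CHAR('a) dvd r" using P prime_dvd_power by blast
  then have "CHAR('a) = r" using P r(1) by (simp add: primes_dvd_imp_eq)
  then show ?thesis
    unfolding cj_eq using freshmans_dream'[OF P, of q n x y] r(3) by simp
qed

lemma cj_minus [simp]: "cj (- x) = - cj x"
  by (metis add_eq_0_iff cj_0 cj_add)

lemma cj_diff [simp]: "cj (x - y) = cj x - cj y"
  using cj_add[of x "- y"] by simp

lemma cj_eq_iff [simp]: "cj x = cj y \<longleftrightarrow> x = y"
  by (metis cj_cj)

text \<open>Root counting bounds both the number of fixed elements and each fibre of the trace
  \<open>x + cj x\<close> by \<open>q\<close>. The trace takes fixed values on a domain of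
  \<open>q * q\<close> elements, so both bounds are attained.\<close>

lemma card_fixed: "card {x. cj x = x} = q"
proof -
  have F0_le: "card {x. cj x = x} \<le> q"
  proof -
    let ?p = "monom 1 q - monom 1 1 :: 'a poly"
    have c: "coeff ?p q = 1" using q_gt_1 by simp
    have "degree ?p \<le> q"
      using q_gt_1 by (intro degree_diff_le) (auto simp: degree_monom_eq)
    moreover have "?p \<noteq> 0" using c by (metis coeff_0 zero_neq_one)
    moreover have "{x. cj x = x} = {x. poly ?p x = 0}"
      by (auto simp: cj_eq poly_monom)
    ultimately show ?thesis using card_poly_roots_bound[of ?p] by simp
  qed
  have le: "card {x \<in> UNIV. x + cj x = t} \<le> q" for t
  proof -
    let ?p = "monom 1 q + monom 1 1 - [:t:] :: 'a poly"
    have c: "coeff ?p q = 1" using q_gt_1 by (simp add: coeff_pCons split: nat.splits)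
    have "degree ?p \<le> q"
      using q_gt_1 by (intro degree_diff_le degree_add_le) (auto simp: degree_monom_eq)
    moreover have "?p \<noteq> 0" using c by (metis coeff_0 zero_neq_one)
    moreover have "{x. x + cj x = t} = {x. poly ?p x = 0}"
      by (auto simp: cj_eq poly_monom algebra_simps)
    ultimately show ?thesis using card_poly_roots_bound[of ?p] by simp
  qed
  note * = card_eq_of_fibres_le(1)[of "{x. cj x = x}" UNIV "\<lambda>x. x + cj x" q q, OF _ _ F0_le le]
  show ?thesis
    by (rule *) (auto simp: card_F power2_eq_square)
qed

text \<open>The (q - 1)(q + 1) nonzero elements are mapped by the norm to q - 1 nonzero fixed
  elements, and a fibre consists of roots of a polynomial of degree q + 1. This is the origin of the
  factors q + 1 in the counts.\<close>

lemma card_norm_fibre: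
  assumes "cj t = t" "t \<noteq> 0"
  shows "card {x. x * cj x = t} = q + 1"
proof -
  let ?T = "{x. cj x = x} - {0}"
  have T: "card ?T = q - 1"
    using card_fixed by (subst card_Diff_subset) auto
  have le: "card {x \<in> UNIV - {0}. x * cj x = t} \<le> q + 1" for t
  proof -
    let ?p = "monom 1 (q + 1) - [:t:] :: 'a poly"
    have c: "coeff ?p (q + 1) = 1" using q_gt_1 by (simp add: coeff_pCons split: nat.splits)
    have "degree ?p \<le> q + 1"
      using q_gt_1 by (intro degree_diff_le) (auto simp: degree_monom_eq)
    moreover have p0: "?p \<noteq> 0" using c by (metis coeff_0 zero_neq_one)
    moreover have "{x \<in> UNIV - {0}. x * cj x = t} \<subseteq> {x. poly ?p x = 0}"
      by (auto simp: cj_eq poly_monom)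
    then have "card {x \<in> UNIV - {0}. x * cj x = t} \<le> card {x. poly ?p x = 0}"
      by (intro card_mono) auto
    ultimately show ?thesis using card_poly_roots_bound[of ?p] by simp
  qed
  have "card (UNIV - {0::'a}) = (q - 1) * (q + 1)"
    using q_gt_1 by (subst card_Diff_subset)
      (auto simp: card_F power2_eq_square algebra_simps diff_mult_distrib)
  then have "card {x \<in> UNIV - {0}. x * cj x = t} = q + 1"
    using assms le T
    by (intro card_eq_of_fibres_le(2)[of ?T "UNIV - {0}" "\<lambda>x. x * cj x" "q - 1" "q + 1"])
      (auto simp: mult.commute intro: exI[of _ 1])
  moreover have "{x \<in> UNIV - {0}. x * cj x = t} = {x. x * cj x = t}" using assms by auto
  ultimately show ?thesis by simp
qed

lemma norm_surj:
  assumes "cj t = t"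
  obtains x where "x * cj x = t"
proof (cases "t = 0")
  case False
  then have "{x. x * cj x = t} \<noteq> {}" using card_norm_fibre[OF assms] by (metis Suc_eq_plus1 card.empty nat.distinct(1))
  then show ?thesis using that by auto
qed (use that[of 0] in auto)

text \<open>Equality of classes in $F^\times / F_0^\times$, with denominators cleared.\<close>

definition sim :: "'a \<Rightarrow> 'a \<Rightarrow> bool" (infix "\<asymp>" 50) where
  "x \<asymp> y \<longleftrightarrow> x \<noteq> 0 \<and> y \<noteq> 0 \<and> cj x * y = x * cj y"

lemma sim_refl_iff [simp]: "x \<asymp> x \<longleftrightarrow> x \<noteq> 0"
  by (auto simp: sim_def)

lemma sim_sym: "x \<asymp> y \<longleftrightarrow> y \<asymp> x"
  by (auto simp: sim_def mult.commute)

text \<open>Since \<open>inverse 0 = 0\<close> and \<open>F0_units q\<close> omits 0, both sides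
  fail for \<open>y = 0\<close>. Hence the unit conditions of the theorem carry their own
  nonvanishing conditions.\<close>

lemma sim_iff_F0_units: "x \<asymp> y \<longleftrightarrow> x * inverse y \<in> F0_units q"
  by (cases "y = 0") (auto simp: sim_def F0_units_def field_simps simp flip: cj_eq)

lemma sim_iff: "x \<asymp> y \<longleftrightarrow> (\<exists>r. cj r = r \<and> r \<noteq> 0 \<and> y \<noteq> 0 \<and> x = r * y)"
proof
  assume "x \<asymp> y"
  then show "\<exists>r. cj r = r \<and> r \<noteq> 0 \<and> y \<noteq> 0 \<and> x = r * y"
    by (intro exI[of _ "x / y"]) (auto simp: sim_def field_simps)
qed (auto simp: sim_def)

lemma simE:
  assumes "x \<asymp> y"
  obtains r where "cj r = r" "r \<noteq> 0" "y \<noteq> 0" "x = r * y"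
  using assms unfolding sim_iff by (elim exE conjE)

lemma sim_trans [trans]: "x \<asymp> y \<Longrightarrow> y \<asymp> z \<Longrightarrow> x \<asymp> z"
proof -
  assume "x \<asymp> y" "y \<asymp> z"
  then obtain r s where "cj r = r" "r \<noteq> 0" "y \<noteq> 0" "x = r * y" "cj s = s" "s \<noteq> 0" "z \<noteq> 0" "y = s * z"
    by (auto elim!: simE)
  then show "x \<asymp> z" by (auto simp: sim_iff intro!: exI[of _ "r * s"])
qed

lemma F0_coset_eq: "x \<noteq> 0 \<Longrightarrow> F0_coset q x = {y. y \<asymp> x}"
  by (auto simp: F0_coset_def F0_units_def sim_iff simp flip: cj_eq)

lemma F0_coset_eq_iff: "x \<noteq> 0 \<Longrightarrow> y \<noteq> 0 \<Longrightarrow> F0_coset q x = F0_coset q y \<longleftrightarrow> x \<asymp> y"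
proof
  assume "x \<noteq> 0" "y \<noteq> 0" "F0_coset q x = F0_coset q y"
  moreover have "x \<in> {y. y \<asymp> x}" using \<open>x \<noteq> 0\<close> by simp
  ultimately show "x \<asymp> y" by (simp add: F0_coset_eq)
next
  assume "x \<noteq> 0" "y \<noteq> 0" and xy: "x \<asymp> y"
  have "z \<asymp> x \<longleftrightarrow> z \<asymp> y" for z
    using sim_trans[of z x y] sim_trans[of z y x] xy sim_sym[of x y] by blast
  then show "F0_coset q x = F0_coset q y" using \<open>x \<noteq> 0\<close> \<open>y \<noteq> 0\<close> by (simp add: F0_coset_eq)
qed

lemma sim_cj [simp]: "cj x \<asymp> cj y \<longleftrightarrow> x \<asymp> y"
  by (auto simp: sim_def mult.commute)

lemma sim_mult_fixed [simp]: "cj r = r \<Longrightarrow> r \<noteq> 0 \<Longrightarrow> r * x \<asymp> y \<longleftrightarrow> x \<asymp> y"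
  by (auto simp: sim_def)

lemma trace_eq_0_sim: "x \<asymp> y \<Longrightarrow> x + cj x = 0 \<longleftrightarrow> y + cj y = 0"
proof -
  assume "x \<asymp> y"
  then obtain r where "cj r = r" "r \<noteq> 0" "x = r * y" by (auto elim!: simE)
  then have "x + cj x = r * (y + cj y)" by (simp add: algebra_simps)
  then show ?thesis using \<open>r \<noteq> 0\<close> by simp
qed

text \<open>On elements of trace zero \<open>cj\<close> is negation, so the quotient of two of them
  is fixed. They form a single class, the one with index 4.\<close>

lemma trace_eq_0_imp_sim: "x \<noteq> 0 \<Longrightarrow> y \<noteq> 0 \<Longrightarrow> x + cj x = 0 \<Longrightarrow> y + cj y = 0 \<Longrightarrow> x \<asymp> y"
proof -
  assume "x \<noteq> 0" "y \<noteq> 0" "x + cj x = 0" "y + cj y = 0"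
  moreover from this have "cj x = - x" "cj y = - y" by (simp_all add: eq_neg_iff_add_eq_0 add.commute)
  ultimately show ?thesis by (simp add: sim_def)
qed

text \<open>A nontrivial relation over the fixed field would make \<open>x / y\<close> a fixed
  element.\<close>

lemma sim_independent:
  assumes "cj r = r" "cj s = s" "cj r' = r'" "cj s' = s'" "x \<noteq> 0" "y \<noteq> 0" "\<not> x \<asymp> y"
    and "r * x + s * y = r' * x + s' * y"
  shows "r = r'" "s = s'"
proof -
  have e: "(r - r') * x = (s' - s) * y" using assms by (simp add: algebra_simps)
  show rr: "r = r'"
  proof (rule ccontr)
    assume "r \<noteq> r'"
    then have "x = ((s' - s) / (r - r')) * y" using e by (simp add: field_simps)
    moreover then have "(s' - s) / (r - r') \<noteq> 0" using assms by auto
    ultimately have "x \<asymp> y" unfolding sim_iff using assms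
      by (intro exI[of _ "(s' - s) / (r - r')"]) auto
    then show False using assms by simp
  qed
  show "s = s'" using e rr assms by simp
qed

end

section \<open>Isotropic lines and the orbits of the unitary group\<close>

lemma U3_iff:
  "\<sigma> \<in> U3 q \<longleftrightarrow> (\<forall>x y. \<sigma> (x + y) = \<sigma> x + \<sigma> y) \<and> (\<forall>t x. \<sigma> (t *s x) = t *s \<sigma> x) \<and>
     bij \<sigma> \<and> (\<forall>x y. herm q (\<sigma> x) (\<sigma> y) = herm q x y)"
  by (auto simp: U3_def Vector_Spaces.linear_iff vec.vector_space_axioms)

lemma U3_linear: "\<sigma> \<in> U3 q \<Longrightarrow> Vector_Spaces.linear (*s) (*s) \<sigma>"
  and U3_bij: "\<sigma> \<in> U3 q \<Longrightarrow> bij \<sigma>"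
  and U3_herm: "\<sigma> \<in> U3 q \<Longrightarrow> herm q (\<sigma> x) (\<sigma> y) = herm q x y"
  by (auto simp: U3_def)

lemma U3_id: "id \<in> U3 q"
  by (auto simp: U3_iff)

lemma U3_comp: "\<sigma> \<in> U3 q \<Longrightarrow> \<rho> \<in> U3 q \<Longrightarrow> \<sigma> \<circ> \<rho> \<in> U3 q"
  by (auto simp: U3_iff intro: bij_comp)

lemma U3_inv:
  assumes "\<sigma> \<in> U3 q"
  shows "inv \<sigma> \<in> U3 q"
proof -
  have s: "\<sigma> (inv \<sigma> x) = x" for x using assms by (simp add: U3_iff bij_is_surj surj_f_inv_f)
  have i: "x = y" if "\<sigma> x = \<sigma> y" for x y
    using injD[OF bij_is_inj[OF U3_bij[OF assms]] that] .
  show ?thesis unfolding U3_iff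
  proof (intro conjI allI)
    show "inv \<sigma> (x + y) = inv \<sigma> x + inv \<sigma> y" for x y
      using assms by - (rule i, simp add: U3_iff s)
    show "inv \<sigma> (t *s x) = t *s inv \<sigma> x" for t x
      using assms by - (rule i, simp add: U3_iff s)
    show "bij (inv \<sigma>)" using assms by (simp add: U3_iff bij_imp_bij_inv)
    show "herm q (inv \<sigma> x) (inv \<sigma> y) = herm q x y" for x y
      using U3_herm[OF assms, of "inv \<sigma> x" "inv \<sigma> y"] by (simp add: s)
  qed
qed

lemma U3_image_line: "\<sigma> \<in> U3 q \<Longrightarrow> \<sigma> ` line x = line (\<sigma> x)"
  by (simp add: U3_linear image_line)

lemma U3_zero_iff: "\<sigma> \<in> U3 q \<Longrightarrow> \<sigma> x = 0 \<longleftrightarrow> x = 0"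
proof -
  assume s: "\<sigma> \<in> U3 q"
  then have "\<sigma> (0 *s 0) = 0 *s \<sigma> 0" unfolding U3_iff by blast
  then have "\<sigma> 0 = 0" by simp
  then show ?thesis using s by (metis U3_bij bij_pointE)
qed

lemma U3_image_inv: "\<sigma> \<in> U3 q \<Longrightarrow> \<sigma> ` inv \<sigma> ` P = P" "\<sigma> \<in> U3 q \<Longrightarrow> inv \<sigma> ` \<sigma> ` P = P"
  by (auto simp: U3_bij bij_is_surj bij_is_inj image_f_inv_f)

lemma U3_image_PC: "\<sigma> \<in> U3 q \<Longrightarrow> P \<in> PC q \<Longrightarrow> \<sigma> ` P \<in> PC q"
proof -
  assume s: "\<sigma> \<in> U3 q" and "P \<in> PC q"
  then obtain x where "x \<noteq> 0" "herm q x x = 0" "P = line x" by (auto simp: PC_def)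
  then have "\<sigma> x \<noteq> 0 \<and> herm q (\<sigma> x) (\<sigma> x) = 0 \<and> \<sigma> ` P = line (\<sigma> x)"
    using s by (simp add: U3_zero_iff U3_herm U3_image_line)
  then show ?thesis unfolding PC_def by auto
qed

lemma U3_image_PC_iff: "\<sigma> \<in> U3 q \<Longrightarrow> \<sigma> ` P \<in> PC q \<longleftrightarrow> P \<in> PC q"
  using U3_image_PC[of \<sigma> q P] U3_image_PC[OF U3_inv, of \<sigma> q "\<sigma> ` P"] by (auto simp: U3_image_inv)

lemma U3_image_eq_iff: "\<sigma> \<in> U3 q \<Longrightarrow> \<sigma> ` P = \<sigma> ` Q \<longleftrightarrow> P = Q"
  by (simp add: U3_bij bij_is_inj inj_image_eq_iff)

lemma line_eq: "line x = range (\<lambda>t. t *s x)"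
  by (simp add: line_def vec.span_singleton)

lemma line_eq_iff:
  assumes "x \<noteq> 0"
  shows "line x = line y \<longleftrightarrow> (\<exists>t. t \<noteq> 0 \<and> y = t *s x)"
proof
  assume *: "line x = line y"
  have "1 *s x \<in> line x" "1 *s y \<in> line y" unfolding line_eq by blast+
  with * have "x \<in> line y" "y \<in> line x" by simp_all
  then obtain t r where "y = t *s x" "x = r *s y" by (auto simp: line_eq)
  then show "\<exists>t. t \<noteq> 0 \<and> y = t *s x" using assms by (intro exI[of _ t]) auto
next
  assume "\<exists>t. t \<noteq> 0 \<and> y = t *s x"
  then obtain t where t: "t \<noteq> 0" "y = t *s x" by blast
  then have "r *s x = (r / t) *s y" "r *s y = (r * t) *s x" for r
    by (simp_all add: vector_smult_assoc)
  then show "line x = line y" unfolding line_eq by (metis (no_types, lifting) rangeE rangeI subsetI subset_antisym)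
qed

lemma line_scale: "t \<noteq> 0 \<Longrightarrow> line (t *s x) = line x"
  by (cases "x = 0") (auto simp: line_eq_iff[of x] intro!: line_eq_iff[THEN iffD2, symmetric])

lemma act3_comp: "act3 (\<sigma> \<circ> \<rho>) T = act3 \<sigma> (act3 \<rho> T)"
  by (cases T) (auto simp: act3_def image_comp)

lemma act3_id: "act3 id T = T"
  by (cases T) (auto simp: act3_def)

lemma act3_inv: "\<sigma> \<in> U3 q \<Longrightarrow> act3 (inv \<sigma>) (act3 \<sigma> T) = T"
  by (cases T) (simp add: act3_def U3_image_inv)

lemma orbit3_refl: "T \<in> orbit3 q T"
  unfolding orbit3_def using U3_id act3_id by (metis (mono_tags, lifting) mem_Collect_eq)

lemma orbit3_act:
  assumes "\<sigma> \<in> U3 q"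
  shows "orbit3 q (act3 \<sigma> T) = orbit3 q T"
proof (intro equalityI subsetI)
  fix X assume "X \<in> orbit3 q (act3 \<sigma> T)"
  then show "X \<in> orbit3 q T"
    unfolding orbit3_def using U3_comp[OF _ assms] by (auto simp flip: act3_comp)
next
  fix X assume "X \<in> orbit3 q T"
  then obtain \<rho> where "\<rho> \<in> U3 q" "X = act3 \<rho> (act3 (inv \<sigma>) (act3 \<sigma> T))"
    unfolding orbit3_def by (auto simp: act3_inv[OF assms])
  then have "\<rho> \<circ> inv \<sigma> \<in> U3 q" "X = act3 (\<rho> \<circ> inv \<sigma>) (act3 \<sigma> T)"
    by (simp_all only: act3_comp U3_comp U3_inv[OF assms])
  then show "X \<in> orbit3 q (act3 \<sigma> T)"
    unfolding orbit3_def by blast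
qed

lemma orbit3_eq: "T' \<in> orbit3 q T \<Longrightarrow> orbit3 q T' = orbit3 q T"
  by (auto simp: orbit3_act orbit3_def[of q T])

lemma act3_mem_orbit3_iff: "\<sigma> \<in> U3 q \<Longrightarrow> act3 \<sigma> X \<in> orbit3 q T \<longleftrightarrow> X \<in> orbit3 q T"
  by (metis orbit3_act orbit3_eq orbit3_refl)

context quadratic_field
begin

abbreviation B :: "'a ^ 3 \<Rightarrow> 'a ^ 3 \<Rightarrow> 'a" where "B \<equiv> herm q"

lemma B_eq: "B x y = x $ 1 * cj (y $ 2) + x $ 2 * cj (y $ 1) + x $ 3 * cj (y $ 3)"
  by (simp add: herm_def cj_eq)

lemma B_simps [simp]:
  "B (x + y) z = B x z + B y z" "B z (x + y) = B z x + B z y"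
  "B (t *s x) z = t * B x z" "B z (t *s x) = cj t * B z x"
  by (simp_all add: B_eq algebra_simps)

lemma cj_B: "cj (B x y) = B y x"
  by (simp add: B_eq algebra_simps)

lemma B_nondegenerate: "x = y" if "\<And>z. B x z = B y z"
proof -
  have "x $ 1 = y $ 1" using that[of "vector [0, 1, 0]"] by (simp add: B_eq)
  moreover have "x $ 2 = y $ 2" using that[of "vector [1, 0, 0]"] by (simp add: B_eq)
  moreover have "x $ 3 = y $ 3" using that[of "vector [0, 0, 1]"] by (simp add: B_eq)
  ultimately show ?thesis by (simp add: vec_eq_iff forall_3)
qed

section \<open>Hyperbolic bases and the isometries they define\<close>

definition hyperbolic_basis :: "'a ^ 3 \<Rightarrow> 'a ^ 3 \<Rightarrow> 'a ^ 3 \<Rightarrow> bool" where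
  "hyperbolic_basis u v w \<longleftrightarrow>
     B u v = 1 \<and> B w w = 1 \<and> B u u = 0 \<and> B v v = 0 \<and> B u w = 0 \<and> B v w = 0"

definition combine :: "'a ^ 3 \<Rightarrow> 'a ^ 3 \<Rightarrow> 'a ^ 3 \<Rightarrow> 'a ^ 3 \<Rightarrow> 'a ^ 3" where
  "combine u v w x = x $ 1 *s u + x $ 2 *s v + x $ 3 *s w"

text \<open>The three vectors have the Gram matrix of the standard basis, so the linear map sending
  that basis to them preserves the form. Nondegeneracy makes it injective, and finiteness then
  bijective.\<close>

lemma combine_in_U3:
  assumes "hyperbolic_basis u v w"
  shows "combine u v w \<in> U3 q"
proof -
  have *: "B u v = 1" "B w w = 1" "B u u = 0" "B v v = 0" "B u w = 0" "B v w = 0"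
    using assms by (simp_all add: hyperbolic_basis_def)
  then have "B v u = 1" "B w u = 0" "B w v = 0"
    by (metis cj_B cj_1, metis cj_B cj_0, metis cj_B cj_0)
  with * have herm: "B (combine u v w x) (combine u v w y) = B x y" for x y
    by (simp add: combine_def B_eq[of x y])
  have "inj (combine u v w)"
    by (rule injI, rule B_nondegenerate) (metis herm)
  then have "bij (combine u v w)"
    by (simp add: bij_def finite_UNIV_inj_surj)
  then show ?thesis
    using herm by (simp add: U3_iff) (simp add: combine_def vec_eq_iff algebra_simps)
qed

text \<open>The third vector is the cross product of the images of \<open>x\<close> and \<open>y\<close> in the dual space.\<close>

lemma hyperbolic_basis_extend:
  assumes "B x x = 0" "B y y = 0" "B x y = 1"
  obtains w where "hyperbolic_basis x y w"
proof
  define w where "w = (vector [cj (x $ 1) * cj (y $ 3) - cj (x $ 3) * cj (y $ 1),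
    cj (x $ 3) * cj (y $ 2) - cj (x $ 2) * cj (y $ 3),
    cj (x $ 2) * cj (y $ 1) - cj (x $ 1) * cj (y $ 2)] :: 'a ^ 3)"
  \<comment> \<open>Lagrange's identity for this form; the sign is reversed because the Gram matrix
    of the standard basis has determinant -1. So \<open>w\<close> has norm 1 without
    rescaling.\<close>
  have "B w w = B x y * cj (B x y) - B x x * B y y"
    by (simp add: B_eq w_def) algebra
  then have "B w w = 1" using assms by simp
  moreover have "B x w = 0" "B y w = 0"
    by (simp_all add: B_eq w_def algebra_simps)
  ultimately show "hyperbolic_basis x y w" using assms by (simp add: hyperbolic_basis_def)
qed

section \<open>Coordinates for isotropic lines\<close>

definition E1 :: "('a ^ 3) set" where "E1 = line (vector [1, 0, 0])"

text \<open>An isotropic line either is \<open>E1\<close> or has exactly one spanning vector with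
  second coordinate 1. So \<open>pt\<close> is an affine chart with \<open>E1\<close> as point at
  infinity.\<close>

definition pt :: "'a \<Rightarrow> 'a \<Rightarrow> ('a ^ 3) set" where "pt \<beta> \<gamma> = line (vector [\<beta>, 1, \<gamma>])"

abbreviation E2 :: "('a ^ 3) set" where "E2 \<equiv> pt 0 0"

definition iso :: "'a \<Rightarrow> 'a \<Rightarrow> bool" where "iso \<beta> \<gamma> \<longleftrightarrow> \<beta> + cj \<beta> + \<gamma> * cj \<gamma> = 0"

lemma iso_0 [simp]: "iso 0 \<gamma> \<longleftrightarrow> \<gamma> = 0" "iso 0 0"
  by (auto simp: iso_def)

lemma vector3_ne_0 [simp]: "(vector [x, y, z] :: 'a ^ 3) = 0 \<longleftrightarrow> x = 0 \<and> y = 0 \<and> z = 0"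
  by (auto simp: vec_eq_iff forall_3)

lemma scale_vector3: "t *s (vector [x, y, z] :: 'a ^ 3) = vector [t * x, t * y, t * z]"
  by (simp add: vec_eq_iff forall_3)

lemma vector3_eq_iff [simp]:
  "(vector [x, y, z] :: 'a ^ 3) = vector [x', y', z'] \<longleftrightarrow> x = x' \<and> y = y' \<and> z = z'"
  by (auto simp: vec_eq_iff forall_3)

lemma B_vector3 [simp]: "B (vector [x, y, z]) (vector [x', y', z']) = x * cj y' + y * cj x' + z * cj z'"
  by (simp add: B_eq)

lemma pt_eq_iff [simp]: "pt \<beta> \<gamma> = pt \<beta>' \<gamma>' \<longleftrightarrow> \<beta> = \<beta>' \<and> \<gamma> = \<gamma>'"
  unfolding pt_def by (subst line_eq_iff) (auto simp: scale_vector3)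

lemma E1_ne_pt [simp]: "E1 \<noteq> pt \<beta> \<gamma>" "pt \<beta> \<gamma> \<noteq> E1"
proof -
  show "E1 \<noteq> pt \<beta> \<gamma>"
    unfolding pt_def E1_def by (subst line_eq_iff) (auto simp: scale_vector3)
  then show "pt \<beta> \<gamma> \<noteq> E1" by simp
qed

lemma PC_iff: "P \<in> PC q \<longleftrightarrow> (\<exists>x. x \<noteq> 0 \<and> B x x = 0 \<and> P = line x)"
  by (auto simp: PC_def)

lemma E1_PC [simp]: "E1 \<in> PC q"
  unfolding PC_iff E1_def by (intro exI[of _ "vector [1, 0, 0]"]) simp

lemma pt_PC [simp]: "pt \<beta> \<gamma> \<in> PC q \<longleftrightarrow> iso \<beta> \<gamma>"
proof
  assume "pt \<beta> \<gamma> \<in> PC q"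
  then obtain x t where "x \<noteq> 0" "B x x = 0" "t \<noteq> 0" "x = t *s vector [\<beta>, 1, \<gamma>]"
    unfolding PC_iff pt_def by (subst (asm) line_eq_iff) auto
  then show "iso \<beta> \<gamma>" by (simp add: iso_def)
next
  assume "iso \<beta> \<gamma>"
  then show "pt \<beta> \<gamma> \<in> PC q"
    unfolding PC_iff pt_def by (intro exI[of _ "vector [\<beta>, 1, \<gamma>]"]) (simp add: iso_def)
qed

lemma PC_cases:
  assumes "P \<in> PC q"
  obtains "P = E1" | \<beta> \<gamma> where "iso \<beta> \<gamma>" "P = pt \<beta> \<gamma>"
proof -
  obtain x where x: "x \<noteq> 0" "B x x = 0" "P = line x" using assms by (auto simp: PC_iff)
  have ex: "x = vector [x $ 1, x $ 2, x $ 3]" by (simp add: vec_eq_iff forall_3)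
  show ?thesis
  proof (cases "x $ 2 = 0")
    case True
    then have "x $ 3 = 0" using x(2) by (simp add: B_eq)
    with True ex have *: "x = x $ 1 *s vector [1, 0, 0]" by (simp add: scale_vector3)
    then have "x $ 1 \<noteq> 0" using x(1) by (metis vector_smult_lzero)
    then have "P = E1" unfolding x(3) E1_def using * line_scale by metis
    then show ?thesis using that by blast
  next
    case False
    then have "x = x $ 2 *s vector [x $ 1 / x $ 2, 1, x $ 3 / x $ 2]"
      by (subst ex) (simp add: scale_vector3)
    then have P: "P = pt (x $ 1 / x $ 2) (x $ 3 / x $ 2)"
      unfolding x(3) pt_def using line_scale[OF False] by metis
    then show ?thesis using that(2) assms by (metis pt_PC)
  qed
qed

lemma finite_PC: "finite (PC q :: ('a ^ 3) set set)"
  by simp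

text \<open>For the representatives \<open>x\<close>, \<open>y\<close> of the two points the left
  side is \<open>B x y + B y x\<close>, which for isotropic vectors is
  \<open>- B (x - y) (x - y)\<close>; and \<open>x - y\<close> has second coordinate 0.\<close>

lemma trace_iso:
  assumes "iso \<beta> \<gamma>" "iso \<beta>' \<gamma>'"
  shows "(\<beta> + cj \<beta>' + \<gamma> * cj \<gamma>') + cj (\<beta> + cj \<beta>' + \<gamma> * cj \<gamma>') = - ((\<gamma> - \<gamma>') * cj (\<gamma> - \<gamma>'))"
  using assms by (simp add: iso_def) algebra

text \<open>The form has Witt index 1. In the chart, orthogonality makes the trace in
  \<open>trace_iso\<close> vanish, hence the \<gamma>-coordinates agree, and then the
  \<beta>-coordinates do.\<close>

lemma isotropic_orthogonal:
  assumes "x \<noteq> 0" "y \<noteq> 0" "B x x = 0" "B y y = 0" "B x y = 0"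
  shows "line x = line y"
proof -
  have P: "line x \<in> PC q" "line y \<in> PC q" using assms by (auto simp: PC_iff)
  have orth: "B x' y' = 0" if xy: "line x = line x'" "line y = line y'" for x' y'
    using xy assms by (auto simp: line_eq_iff)
  from P(1) show ?thesis
  proof (cases rule: PC_cases)
    case 1
    from P(2) show ?thesis
    proof (cases rule: PC_cases)
      case 1 with \<open>line x = E1\<close> show ?thesis by simp
    next
      case (2 \<beta> \<gamma>)
      then show ?thesis using 1 orth[of "vector [1, 0, 0]" "vector [\<beta>, 1, \<gamma>]"] by (simp add: E1_def pt_def)
    qed
  next
    case x: (2 \<beta> \<gamma>)
    from P(2) show ?thesis
    proof (cases rule: PC_cases)
      case 1
      then show ?thesis using x orth[of "vector [\<beta>, 1, \<gamma>]" "vector [1, 0, 0]"] by (simp add: E1_def pt_def)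
    next
      case y: (2 \<beta>' \<gamma>')
      have z: "\<beta> + cj \<beta>' + \<gamma> * cj \<gamma>' = 0"
        using x y orth[of "vector [\<beta>, 1, \<gamma>]" "vector [\<beta>', 1, \<gamma>']"] by (simp add: pt_def)
      then have "\<gamma> = \<gamma>'" using trace_iso[OF x(1) y(1)] by simp
      moreover from this have "\<beta> = \<beta>'" using z y(1) unfolding iso_def by (metis add.assoc add_right_cancel)
      ultimately show ?thesis using x y by simp
    qed
  qed
qed

lemma two_transitive:
  assumes "P \<in> PC q" "Q \<in> PC q" "P \<noteq> Q"
  obtains \<sigma> where "\<sigma> \<in> U3 q" "\<sigma> ` E1 = P" "\<sigma> ` E2 = Q"
proof -
  obtain x y where x: "x \<noteq> 0" "B x x = 0" "P = line x" and y: "y \<noteq> 0" "B y y = 0" "Q = line y"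
    using assms(1,2) by (auto simp: PC_iff)
  have nz: "B x y \<noteq> 0" using isotropic_orthogonal[OF x(1) y(1) x(2) y(2)] x y assms by auto
  \<comment> \<open>The conjugate compensates the semilinearity of the second argument, so that
    \<open>B x y' = 1\<close> and the pair extends to a hyperbolic basis.\<close>
  define y' where "y' = inverse (cj (B x y)) *s y"
  have y': "B y' y' = 0" "B x y' = 1" "Q = line y'"
    using nz y by (simp_all add: y'_def line_scale)
  obtain w where "hyperbolic_basis x y' w"
    using hyperbolic_basis_extend[OF x(2) y'(1,2)] .
  then have s: "combine x y' w \<in> U3 q" by (rule combine_in_U3)
  show ?thesis
    by (rule that[OF s])
      (simp_all add: E1_def pt_def U3_image_line[OF s] x y', simp_all add: combine_def)
qed

lemma triple_standard_form:
  assumes "P \<in> PC q" "Q \<in> PC q" "S \<in> PC q" "P \<noteq> Q" "P \<noteq> S" "Q \<noteq> S"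
  obtains \<sigma> \<beta> \<gamma> where "\<sigma> \<in> U3 q" "(P, Q, S) = act3 \<sigma> (E1, E2, pt \<beta> \<gamma>)" "iso \<beta> \<gamma>" "\<beta> \<noteq> 0"
proof -
  obtain \<sigma> where s: "\<sigma> \<in> U3 q" "\<sigma> ` E1 = P" "\<sigma> ` E2 = Q" using two_transitive assms by metis
  have S: "S = \<sigma> ` (inv \<sigma> ` S)" using s by (simp add: U3_image_inv)
  have "inv \<sigma> ` S \<in> PC q" using s assms by (simp add: U3_image_PC U3_inv)
  then show ?thesis
  proof (cases rule: PC_cases)
    case 1
    then show ?thesis using S s assms by simp
  next
    case (2 \<beta> \<gamma>)
    moreover have "\<beta> \<noteq> 0" using 2 S s assms by auto
    ultimately show ?thesis using that[OF s(1), of \<beta> \<gamma>] S s by (simp add: act3_def)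
  qed
qed

text \<open>Up to norms, \<open>triangle\<close> depends only on the three lines; it is the conjugate of the
  usual triple product, so that it takes the value \<open>\<beta>\<close> in standard position.\<close>

definition triangle :: "'a ^ 3 \<Rightarrow> 'a ^ 3 \<Rightarrow> 'a ^ 3 \<Rightarrow> 'a" where
  "triangle x y z = B y x * B z y * B x z"

lemma triangle_sim:
  assumes "line x = line x'" "line y = line y'" "line z = line z'" "x \<noteq> 0" "y \<noteq> 0" "z \<noteq> 0"
  shows "triangle x' y' z' \<asymp> \<beta> \<longleftrightarrow> triangle x y z \<asymp> \<beta>"
proof -
  obtain r s t where r: "r \<noteq> 0" "x' = r *s x" and s: "s \<noteq> 0" "y' = s *s y" and t: "t \<noteq> 0" "z' = t *s z"
    using assms by (auto simp: line_eq_iff)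
  define n where "n = (r * cj r) * (s * cj s) * (t * cj t)"
  have "triangle x' y' z' = n * triangle x y z"
    unfolding triangle_def n_def r s t by (simp add: algebra_simps)
  moreover have "cj n = n" "n \<noteq> 0" using r s t by (simp_all add: n_def algebra_simps)
  ultimately show ?thesis by simp
qed

text \<open>Write \<open>\<beta>' = r * \<beta>\<close> and let \<open>s\<close> have norm
  \<open>r\<close>. If \<open>t\<close> has norm 1, the isometry diag(s, 1 / cj s, t) sends
  (\<beta>, 1, \<gamma>) to a multiple of (r \<beta>, 1, cj s t \<gamma>), so it remains to choose
  \<open>t\<close> to match \<open>\<gamma>'\<close>.\<close>

lemma standard_orbit_sim:
  assumes "iso \<beta> \<gamma>" "iso \<beta>' \<gamma>'" "\<beta>' \<asymp> \<beta>"
  shows "(E1, E2, pt \<beta>' \<gamma>') \<in> orbit3 q (E1, E2, pt \<beta> \<gamma>)"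
proof -
  obtain r where r: "cj r = r" "r \<noteq> 0" "\<beta> \<noteq> 0" "\<beta>' = r * \<beta>" using assms(3) by (rule simE)
  obtain s where s: "s * cj s = r" using norm_surj[OF r(1)] .
  have s0: "s \<noteq> 0" using s r by auto
  \<comment> \<open>By isotropy these norms are the negative traces of \<open>\<beta>'\<close> and
    \<open>\<beta>\<close>, hence differ by the same factor \<open>r\<close>.\<close>
  have g: "\<gamma>' * cj \<gamma>' = r * (\<gamma> * cj \<gamma>)"
    using assms(1,2) r by (simp add: iso_def) algebra
  obtain t where t: "t * cj t = 1" "\<gamma>' = cj s * t * \<gamma>"
  proof (cases "\<gamma> = 0")
    case True
    then show ?thesis using that[of 1] g by simp
  next
    case False
    show ?thesis
      by (rule that[of "\<gamma>' / (cj s * \<gamma>)"]) (use False s0 s g in \<open>auto simp: field_simps\<close>)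
  qed
  let ?u = "s *s vector [1, 0, 0] :: 'a ^ 3" and ?v = "inverse (cj s) *s vector [0, 1, 0] :: 'a ^ 3"
    and ?w = "t *s vector [0, 0, 1] :: 'a ^ 3"
  have "hyperbolic_basis ?u ?v ?w"
    using s0 t by (simp add: hyperbolic_basis_def mult.commute)
  then have m: "combine ?u ?v ?w \<in> U3 q" by (rule combine_in_U3)
  have "combine ?u ?v ?w (vector [\<beta>, 1, \<gamma>]) = inverse (cj s) *s vector [\<beta>', 1, \<gamma>']"
    using s0 s r t by (simp add: combine_def vec_eq_iff forall_3 field_simps)
  then have "combine ?u ?v ?w ` pt \<beta> \<gamma> = pt \<beta>' \<gamma>'"
    using s0 by (simp add: pt_def U3_image_line[OF m] line_scale)
  moreover have "combine ?u ?v ?w ` E1 = E1" "combine ?u ?v ?w ` E2 = E2"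
    using s0 by (simp_all add: pt_def E1_def U3_image_line[OF m]) (simp_all add: combine_def line_scale)
  ultimately have "(E1, E2, pt \<beta>' \<gamma>') = act3 (combine ?u ?v ?w) (E1, E2, pt \<beta> \<gamma>)"
    by (simp add: act3_def)
  then show ?thesis using m unfolding orbit3_def by blast
qed

lemma orbit_imp_triangle_sim:
  assumes "x \<noteq> 0" "y \<noteq> 0" "z \<noteq> 0" "\<beta> \<noteq> 0"
    and "(line x, line y, line z) \<in> orbit3 q (E1, E2, pt \<beta> \<gamma>)"
  shows "triangle x y z \<asymp> \<beta>"
proof -
  obtain \<sigma> where s: "\<sigma> \<in> U3 q" "line x = \<sigma> ` E1" "line y = \<sigma> ` E2" "line z = \<sigma> ` pt \<beta> \<gamma>"
    using assms(5) by (auto simp: orbit3_def act3_def)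
  let ?x = "\<sigma> (vector [1, 0, 0])" and ?y = "\<sigma> (vector [0, 1, 0])" and ?z = "\<sigma> (vector [\<beta>, 1, \<gamma>])"
  have "triangle ?x ?y ?z \<asymp> \<beta> \<longleftrightarrow> triangle x y z \<asymp> \<beta>"
    using assms s by (intro triangle_sim) (simp_all add: E1_def pt_def U3_image_line)
  moreover have "triangle ?x ?y ?z = \<beta>" using s(1) by (simp add: triangle_def U3_herm)
  ultimately show ?thesis using assms by simp
qed

text \<open>Conversely, a nonzero \<open>triangle\<close> forces three distinct lines; their
  standard form has some parameter \<open>\<beta>'\<close>, invariance gives
  \<open>\<beta>' \<asymp> \<beta>\<close>, and \<open>standard_orbit_sim\<close> joins the two
  orbits.\<close>

lemma orbit_iff_triangle_sim:
  assumes "x \<noteq> 0" "y \<noteq> 0" "z \<noteq> 0" "B x x = 0" "B y y = 0" "B z z = 0" "iso \<beta> \<gamma>" "\<beta> \<noteq> 0"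
  shows "(line x, line y, line z) \<in> orbit3 q (E1, E2, pt \<beta> \<gamma>) \<longleftrightarrow> triangle x y z \<asymp> \<beta>"
proof
  assume *: "triangle x y z \<asymp> \<beta>"
  then have nz: "B y x \<noteq> 0" "B z y \<noteq> 0" "B x z \<noteq> 0" by (auto simp: sim_def triangle_def)
  then have "line x \<noteq> line y" "line x \<noteq> line z" "line y \<noteq> line z"
    using assms by (auto simp: line_eq_iff)
  moreover have "line x \<in> PC q" "line y \<in> PC q" "line z \<in> PC q"
    using assms by (auto simp: PC_iff)
  ultimately obtain \<sigma> \<beta>' \<gamma>' where s: "\<sigma> \<in> U3 q" "(line x, line y, line z) = act3 \<sigma> (E1, E2, pt \<beta>' \<gamma>')"
    "iso \<beta>' \<gamma>'" "\<beta>' \<noteq> 0"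
    using triple_standard_form by metis
  then have o: "(line x, line y, line z) \<in> orbit3 q (E1, E2, pt \<beta>' \<gamma>')"
    unfolding orbit3_def by blast
  then have "triangle x y z \<asymp> \<beta>'"
    using assms s by (intro orbit_imp_triangle_sim) auto
  then have "\<beta>' \<asymp> \<beta>" using * sim_sym sim_trans by blast
  then have "(E1, E2, pt \<beta>' \<gamma>') \<in> orbit3 q (E1, E2, pt \<beta> \<gamma>)"
    using standard_orbit_sim assms s by blast
  then show "(line x, line y, line z) \<in> orbit3 q (E1, E2, pt \<beta> \<gamma>)"
    using o orbit3_eq by blast
qed (use assms orbit_imp_triangle_sim in blast)

end

section \<open>The orbits form an association scheme on triples\<close>

context quadratic_field
begin

lemma sim_add: "x \<asymp> e \<Longrightarrow> y \<asymp> e \<Longrightarrow> x + y \<noteq> 0 \<Longrightarrow> x + y \<asymp> e"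
  by (simp add: sim_def algebra_simps)

lemma sim_sum_unique:
  assumes "x \<asymp> e" "x' \<asymp> e" "y \<asymp> f" "y' \<asymp> f" "x + y = x' + y'" "\<not> e \<asymp> f"
  shows "x = x'" "y = y'"
proof -
  obtain r r' s s' where *: "cj r = r" "x = r * e" "cj r' = r'" "x' = r' * e"
    "cj s = s" "y = s * f" "cj s' = s'" "y' = s' * f" "e \<noteq> 0" "f \<noteq> 0"
    using assms by (auto elim!: simE)
  then have "r = r'" "s = s'"
    using sim_independent[of r s r' s' e f] assms by auto
  with * show "x = x'" "y = y'" by simp_all
qed

text \<open>The inverse of \<open>x\<close> is \<open>cj x\<close> divided by the norm of
  \<open>x\<close>.\<close>

lemma inverse_sim: "x \<noteq> 0 \<Longrightarrow> inverse x \<asymp> y \<longleftrightarrow> cj x \<asymp> y"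
  using sim_mult_fixed[of "x * cj x" "inverse x" y] by (simp add: mult.commute field_simps)

lemma minus_sim [simp]: "- x \<asymp> y \<longleftrightarrow> x \<asymp> y"
  by (simp add: sim_def)

lemma sim_cong: "x \<asymp> x' \<Longrightarrow> x \<asymp> y \<longleftrightarrow> x' \<asymp> y"
  using sim_trans[of x x' y] sim_trans[of x' x y] sim_sym[of x x'] by blast

lemma sim_cong2: "y \<asymp> y' \<Longrightarrow> x \<asymp> y \<longleftrightarrow> x \<asymp> y'"
  using sim_cong[of y y' x] by (simp add: sim_sym[of x])

lemma card_sim_class:
  assumes "e \<noteq> 0"
  shows "card {x. x \<asymp> e} = q - 1"
proof -
  have "{x. x \<asymp> e} = (\<lambda>r. r * e) ` ({r. cj r = r} - {0})"
    using assms by (auto simp: sim_iff)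
  moreover have "inj_on (\<lambda>r. r * e) ({r. cj r = r} - {0})"
    using assms by (auto simp: inj_on_def)
  moreover have "card ({r. cj r = r} - {0}) = q - 1"
    using card_fixed by (subst card_Diff_subset) auto
  ultimately show ?thesis by (simp add: card_image)
qed

text \<open>The norm of \<gamma> must be minus the trace of \<beta>: only 0 works if that vanishes,
  and a full norm fibre otherwise.\<close>

lemma card_iso_fibre: "card {\<gamma>. iso \<beta> \<gamma>} = (if \<beta> + cj \<beta> = 0 then 1 else q + 1)"
proof (cases "\<beta> + cj \<beta> = 0")
  case True
  then have "{\<gamma>. iso \<beta> \<gamma>} = {0}" by (auto simp: iso_def)
  with True show ?thesis by simp
next
  case False
  have "{\<gamma>. iso \<beta> \<gamma>} = {\<gamma>. \<gamma> * cj \<gamma> = - (\<beta> + cj \<beta>)}"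
    unfolding iso_def by (simp only: add_eq_0_iff)
  moreover have "- (\<beta> + cj \<beta>) \<noteq> 0" using False by (metis neg_0_equal_iff_equal)
  ultimately show ?thesis
    using False card_norm_fibre[of "- (\<beta> + cj \<beta>)"] by (simp add: add.commute)
qed

lemma standard_orbit_iff:
  assumes "iso \<beta> \<gamma>" "\<beta> \<noteq> 0"
  shows "(E1, E2, pt \<beta>' \<gamma>') \<in> orbit3 q (E1, E2, pt \<beta> \<gamma>) \<longleftrightarrow> iso \<beta>' \<gamma>' \<and> \<beta>' \<asymp> \<beta>"
proof -
  have "iso \<beta>' \<gamma>'" if "(E1, E2, pt \<beta>' \<gamma>') \<in> orbit3 q (E1, E2, pt \<beta> \<gamma>)"
  proof -
    obtain \<sigma> where "\<sigma> \<in> U3 q" "pt \<beta>' \<gamma>' = \<sigma> ` pt \<beta> \<gamma>"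
      using \<open>(E1, E2, pt \<beta>' \<gamma>') \<in> _\<close> by (auto simp: orbit3_def act3_def)
    then have "pt \<beta>' \<gamma>' \<in> PC q" using assms by (simp add: U3_image_PC)
    then show ?thesis by simp
  qed
  moreover have "(E1, E2, pt \<beta>' \<gamma>') \<in> orbit3 q (E1, E2, pt \<beta> \<gamma>) \<longleftrightarrow> \<beta>' \<asymp> \<beta>" if "iso \<beta>' \<gamma>'"
    using orbit_iff_triangle_sim[of "vector [1, 0, 0]" "vector [0, 1, 0]" "vector [\<beta>', 1, \<gamma>']" \<beta> \<gamma>]
      assms that by (simp add: triangle_def iso_def flip: E1_def pt_def)
  ultimately show ?thesis by blast
qed

lemma standard_orbit_eq_iff:
  assumes "iso \<beta> \<gamma>" "\<beta> \<noteq> 0" "iso \<beta>' \<gamma>'" "\<beta>' \<noteq> 0"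
  shows "orbit3 q (E1, E2, pt \<beta> \<gamma>) = orbit3 q (E1, E2, pt \<beta>' \<gamma>') \<longleftrightarrow> \<beta> \<asymp> \<beta>'"
  using standard_orbit_iff[OF assms(3,4), of \<beta> \<gamma>] assms(1)
    orbit3_refl[of "(E1, E2, pt \<beta> \<gamma>)" q] orbit3_eq[of "(E1, E2, pt \<beta> \<gamma>)" q "(E1, E2, pt \<beta>' \<gamma>')"]
  by auto

lemma permute_triple_act3: "permute_triple \<pi> (act3 \<sigma> T) = act3 \<sigma> (permute_triple \<pi> T)"
  by (cases T) (auto simp: permute_triple_def act3_def)

lemma orbit3_eq_image: "orbit3 q T = (\<lambda>\<sigma>. act3 \<sigma> T) ` U3 q"
  by (auto simp: orbit3_def)

lemma permute_triple_orbit3: "permute_triple \<pi> ` orbit3 q T = orbit3 q (permute_triple \<pi> T)"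
  by (simp only: orbit3_eq_image image_image permute_triple_act3)

end

text \<open>The data of the theorem moved to the standard basis, with the pair (a, 0) stored at
  index 4. The indices 4 to q + 4 then label all q + 1 classes of units uniformly.\<close>

locale unitary_scheme = quadratic_field q cj
  for q and cj :: "'a::{field, finite} \<Rightarrow> 'a" +
  fixes d c :: "nat \<Rightarrow> 'a"
    and R :: "nat \<Rightarrow> (('a ^ 3) set \<times> ('a ^ 3) set \<times> ('a ^ 3) set) set"
  assumes d_ne_0: "i \<in> {4..q+4} \<Longrightarrow> d i \<noteq> 0"
    and d_iso: "i \<in> {4..q+4} \<Longrightarrow> iso (d i) (c i)"
    and d_unique: "i \<in> {4..q+4} \<Longrightarrow> j \<in> {4..q+4} \<Longrightarrow> d i \<asymp> d j \<Longrightarrow> i = j"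
    and d_exhaust: "x \<noteq> 0 \<Longrightarrow> \<exists>i\<in>{4..q+4}. x \<asymp> d i"
    and c_4: "c 4 = 0"
    and R0: "R 0 = {(x, x, x) | x. x \<in> PC q}"
    and R1: "R 1 = {(y, x, x) | x y. x \<in> PC q \<and> y \<in> PC q \<and> x \<noteq> y}"
    and R2: "R 2 = {(x, y, x) | x y. x \<in> PC q \<and> y \<in> PC q \<and> x \<noteq> y}"
    and R3: "R 3 = {(x, x, y) | x y. x \<in> PC q \<and> y \<in> PC q \<and> x \<noteq> y}"
    and R_orbit: "i \<in> {4..q+4} \<Longrightarrow> R i = orbit3 q (E1, E2, pt (d i) (c i))"
begin

definition base :: "nat \<Rightarrow> ('a ^ 3) set \<times> ('a ^ 3) set \<times> ('a ^ 3) set" where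
  "base l = (if l = 0 then (E1, E1, E1) else if l = 1 then (E1, E2, E2)
     else if l = 2 then (E1, E2, E1) else if l = 3 then (E1, E1, E2)
     else (E1, E2, pt (d l) (c l)))"

lemma nat_range_cases:
  assumes "l \<in> {0..q+4}"
  obtains "l = 0" | "l = 1" | "l = 2" | "l = 3" | "l \<in> {4..q+4}"
  using assms by (cases "l = 0"; cases "l = 1"; cases "l = 2"; cases "l = 3") auto

text \<open>By 2-transitivity the four trivial relations are single orbits too, so all relations can
  be handled alike through their \<open>base\<close> triples.\<close>

lemma R_eq:
  assumes "l \<in> {0..q+4}"
  shows "R l = orbit3 q (base l)"
proof -
  have orb: "(\<sigma> ` P, \<sigma> ` Q, \<sigma> ` S) \<in> orbit3 q (P, Q, S)" if "\<sigma> \<in> U3 q" for \<sigma> P Q S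
    using act3_mem_orbit3_iff[OF that, of "(P, Q, S)" "(P, Q, S)"] by (simp add: act3_def orbit3_refl)
  have orbE: "\<exists>\<sigma>\<in>U3 q. T = (\<sigma> ` P, \<sigma> ` Q, \<sigma> ` S)" if "T \<in> orbit3 q (P, Q, S)" for T P Q S
    using that by (auto simp: orbit3_def act3_def)
  have *: "\<exists>\<sigma>\<in>U3 q. \<sigma> ` E1 = P \<and> \<sigma> ` E2 = Q" if "P \<in> PC q" "Q \<in> PC q" "P \<noteq> Q" for P Q
    using two_transitive[OF that] by metis
  have 0: "orbit3 q (E1, E1, E1) = R 0"
  proof (intro equalityI subsetI)
    fix T assume "T \<in> R 0"
    then obtain P where T: "T = (P, P, P)" "P \<in> PC q" by (auto simp: R0)
    \<comment> \<open>Any second line will do: it makes 2-transitivity applicable to a single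
      point.\<close>
    obtain Q where "Q \<in> PC q" "P \<noteq> Q" using E1_PC pt_PC[of 0 0] E1_ne_pt(1) iso_0 by metis
    with T *[of P Q] obtain \<sigma> where "\<sigma> \<in> U3 q" "\<sigma> ` E1 = P" by metis
    then show "T \<in> orbit3 q (E1, E1, E1)" using orb[of \<sigma> E1 E1 E1] T by simp
  next
    fix T assume "T \<in> orbit3 q (E1, E1, E1)"
    then show "T \<in> R 0" using orbE U3_image_PC[OF _ E1_PC] unfolding R0 by blast
  qed
  have 1: "orbit3 q (E1, E2, E2) = R 1"
  proof (intro equalityI subsetI)
    fix T assume "T \<in> R 1"
    then obtain x y where T: "T = (y, x, x)" "x \<in> PC q" "y \<in> PC q" "y \<noteq> x"
      unfolding R1 by blast
    with *[of y x] obtain \<sigma> where "\<sigma> \<in> U3 q" "\<sigma> ` E1 = y" "\<sigma> ` E2 = x" by metis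
    then show "T \<in> orbit3 q (E1, E2, E2)" using orb[of \<sigma> E1 E2 E2] T by simp
  next
    fix T assume "T \<in> orbit3 q (E1, E2, E2)"
    then obtain \<sigma> where s: "\<sigma> \<in> U3 q" "T = (\<sigma> ` E1, \<sigma> ` E2, \<sigma> ` E2)"
      using orbE by metis
    then have "\<sigma> ` E1 \<in> PC q" "\<sigma> ` E2 \<in> PC q" "\<sigma> ` E1 \<noteq> \<sigma> ` E2"
      by (simp_all add: U3_image_PC U3_image_eq_iff)
    then show "T \<in> R 1" unfolding R1 s(2) by blast
  qed
  have 2: "orbit3 q (E1, E2, E1) = R 2"
  proof (intro equalityI subsetI)
    fix T assume "T \<in> R 2"
    then obtain x y where T: "T = (x, y, x)" "x \<in> PC q" "y \<in> PC q" "x \<noteq> y"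
      unfolding R2 by blast
    with *[of x y] obtain \<sigma> where "\<sigma> \<in> U3 q" "\<sigma> ` E1 = x" "\<sigma> ` E2 = y" by metis
    then show "T \<in> orbit3 q (E1, E2, E1)" using orb[of \<sigma> E1 E2 E1] T by simp
  next
    fix T assume "T \<in> orbit3 q (E1, E2, E1)"
    then obtain \<sigma> where s: "\<sigma> \<in> U3 q" "T = (\<sigma> ` E1, \<sigma> ` E2, \<sigma> ` E1)"
      using orbE by metis
    then have "\<sigma> ` E1 \<in> PC q" "\<sigma> ` E2 \<in> PC q" "\<sigma> ` E1 \<noteq> \<sigma> ` E2"
      by (simp_all add: U3_image_PC U3_image_eq_iff)
    then show "T \<in> R 2" unfolding R2 s(2) by blast
  qed
  have 3: "orbit3 q (E1, E1, E2) = R 3"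
  proof (intro equalityI subsetI)
    fix T assume "T \<in> R 3"
    then obtain x y where T: "T = (x, x, y)" "x \<in> PC q" "y \<in> PC q" "x \<noteq> y"
      unfolding R3 by blast
    with *[of x y] obtain \<sigma> where "\<sigma> \<in> U3 q" "\<sigma> ` E1 = x" "\<sigma> ` E2 = y" by metis
    then show "T \<in> orbit3 q (E1, E1, E2)" using orb[of \<sigma> E1 E1 E2] T by simp
  next
    fix T assume "T \<in> orbit3 q (E1, E1, E2)"
    then obtain \<sigma> where s: "\<sigma> \<in> U3 q" "T = (\<sigma> ` E1, \<sigma> ` E1, \<sigma> ` E2)"
      using orbE by metis
    then have "\<sigma> ` E1 \<in> PC q" "\<sigma> ` E2 \<in> PC q" "\<sigma> ` E1 \<noteq> \<sigma> ` E2"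
      by (simp_all add: U3_image_PC U3_image_eq_iff)
    then show "T \<in> R 3" unfolding R3 s(2) by blast
  qed
  from assms show ?thesis
    by (cases rule: nat_range_cases) (simp_all add: base_def 0 1 2 3 R_orbit)
qed

lemma act3_mem_R_iff:
  assumes "\<sigma> \<in> U3 q" "l \<in> {0..q+4}"
  shows "(\<sigma> ` x, \<sigma> ` y, \<sigma> ` z) \<in> R l \<longleftrightarrow> (x, y, z) \<in> R l"
  using act3_mem_orbit3_iff[OF assms(1), of "(x, y, z)"] by (simp add: R_eq[OF assms(2)] act3_def)

lemma base_PC: "l \<in> {0..q+4} \<Longrightarrow> base l \<in> PC q \<times> PC q \<times> PC q"
  by (cases l rule: nat_range_cases) (simp_all add: base_def d_iso)

lemma base_in_R: "l \<in> {0..q+4} \<Longrightarrow> base l \<in> R l"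
  by (simp add: R_eq orbit3_refl)

lemma R_subset: "l \<in> {0..q+4} \<Longrightarrow> R l \<subseteq> PC q \<times> PC q \<times> PC q"
  using base_PC[of l] by (cases "base l") (auto simp: R_eq orbit3_def act3_def U3_image_PC)

lemma R_distinct:
  assumes "l \<in> {4..q+4}" "(x, y, z) \<in> R l"
  shows "x \<noteq> y" "x \<noteq> z" "y \<noteq> z"
proof -
  obtain \<sigma> where "\<sigma> \<in> U3 q" "x = \<sigma> ` E1" "y = \<sigma> ` E2" "z = \<sigma> ` pt (d l) (c l)"
    using assms(2) by (auto simp: R_orbit[OF assms(1)] orbit3_def act3_def)
  then show "x \<noteq> y" "x \<noteq> z" "y \<noteq> z"
    using d_ne_0[OF assms(1)] by (simp_all add: U3_image_eq_iff)
qed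

lemma R_cover:
  assumes "T \<in> PC q \<times> PC q \<times> PC q"
  obtains l where "l \<in> {0..q+4}" "T \<in> R l"
proof -
  obtain x y z where T: "T = (x, y, z)" "x \<in> PC q" "y \<in> PC q" "z \<in> PC q" using assms by auto
  consider "x = y" "y = z" | "x \<noteq> y" "y = z" | "x \<noteq> y" "x = z" | "x = y" "y \<noteq> z"
    | "x \<noteq> y" "y \<noteq> z" "x \<noteq> z" by blast
  then show ?thesis
  proof cases
    case 1
    then have "T \<in> R 0" using T unfolding R0 by blast
    then show ?thesis using that[of 0] by simp
  next
    case 2
    then have "T \<in> R 1" using T unfolding R1 by blast
    then show ?thesis using that[of 1] by simp
  next
    case 3
    then have "T \<in> R 2" using T unfolding R2 by blast
    then show ?thesis using that[of 2] by simp
  next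
    case 4
    then have "T \<in> R 3" using T unfolding R3 by blast
    then show ?thesis using that[of 3] by simp
  next
    case 5
    then obtain \<sigma> \<beta> \<gamma> where s: "\<sigma> \<in> U3 q" "(x, y, z) = act3 \<sigma> (E1, E2, pt \<beta> \<gamma>)" "iso \<beta> \<gamma>" "\<beta> \<noteq> 0"
      using triple_standard_form T by metis
    obtain l where l: "l \<in> {4..q+4}" "\<beta> \<asymp> d l" using d_exhaust[OF s(4)] by blast
    then have "(E1, E2, pt \<beta> \<gamma>) \<in> R l"
      using s by (simp add: R_orbit standard_orbit_iff d_iso d_ne_0)
    then have "T \<in> R l" using s l unfolding T R_orbit[OF l(1)] by (simp add: act3_mem_orbit3_iff)
    then show ?thesis using that[of l] l by simp
  qed
qed

text \<open>The pattern of equal entries separates the trivial relations from each other and from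
  the rest; among the rest the class of the invariant decides.\<close>

lemma R_disjoint:
  assumes "l \<in> {0..q+4}" "l' \<in> {0..q+4}" "T \<in> R l" "T \<in> R l'"
  shows "l = l'"
proof -
  obtain x y z where T: "T = (x, y, z)" by (cases T)
  have "l = l'" if "l \<in> {4..q+4}" "l' \<in> {4..q+4}"
  proof -
    have "R l = R l'" using assms by (metis R_eq orbit3_eq)
    then have "d l \<asymp> d l'"
      using that by (simp add: R_orbit standard_orbit_eq_iff d_iso d_ne_0)
    then show ?thesis using that d_unique by blast
  qed
  moreover have low: "(x, y, z) \<in> R 0 \<Longrightarrow> x = y \<and> y = z" "(x, y, z) \<in> R 1 \<Longrightarrow> x \<noteq> y \<and> y = z"
      "(x, y, z) \<in> R 2 \<Longrightarrow> x \<noteq> y \<and> x = z" "(x, y, z) \<in> R 3 \<Longrightarrow> x = y \<and> y \<noteq> z"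
    unfolding R0 R1 R2 R3 by blast+
  moreover have False if "m \<in> {4..q+4}" "n \<in> {0,1,2,3}" "T \<in> R m" "T \<in> R n" for m n
    using that(2) that(4) low R_distinct[OF that(1) that(3)[unfolded T]] unfolding T
    by (elim insertE emptyE; hypsubst; blast)
  moreover have "l = l'" if "l \<in> {0,1,2,3}" "l' \<in> {0,1,2,3}"
    using that assms(3,4) low unfolding T
    by (elim insertE emptyE; hypsubst; (rule refl | blast))
  moreover have "n \<in> {0,1,2,3} \<or> n \<in> {4..q+4}" if "n \<in> {0..q+4}" for n
    using that by auto
  ultimately show ?thesis using assms by metis
qed

lemma triple_count_act:
  assumes "\<sigma> \<in> U3 q" "i \<in> {0..q+4}" "j \<in> {0..q+4}" "k \<in> {0..q+4}"
  shows "triple_count (PC q) R i j k (\<sigma> ` x) (\<sigma> ` y) (\<sigma> ` z) = triple_count (PC q) R i j k x y z"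
proof -
  let ?A = "\<lambda>x y z. {\<omega> \<in> PC q. (\<omega>, y, z) \<in> R i \<and> (x, \<omega>, z) \<in> R j \<and> (x, y, \<omega>) \<in> R k}"
  have mem: "\<sigma> ` \<omega> \<in> ?A (\<sigma> ` x) (\<sigma> ` y) (\<sigma> ` z) \<longleftrightarrow> \<omega> \<in> ?A x y z" for \<omega>
    using assms by (simp add: act3_mem_R_iff U3_image_PC_iff)
  have "?A (\<sigma> ` x) (\<sigma> ` y) (\<sigma> ` z) = image \<sigma> ` ?A x y z"
  proof (intro equalityI subsetI)
    fix \<omega> assume "\<omega> \<in> ?A (\<sigma> ` x) (\<sigma> ` y) (\<sigma> ` z)"
    then have "inv \<sigma> ` \<omega> \<in> ?A x y z" using mem[of "inv \<sigma> ` \<omega>"] assms(1) by (simp only: U3_image_inv)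
    then show "\<omega> \<in> image \<sigma> ` ?A x y z" by (rule rev_image_eqI) (simp only: U3_image_inv[OF assms(1)])
  qed (use mem in blast)
  then show ?thesis
    unfolding triple_count_def
    using assms(1) by (simp add: card_image inj_on_def U3_image_eq_iff)
qed

lemma triple_count_base:
  assumes "i \<in> {0..q+4}" "j \<in> {0..q+4}" "k \<in> {0..q+4}" "l \<in> {0..q+4}"
    "(x, y, z) \<in> R l" "base l = (x', y', z')"
  shows "triple_count (PC q) R i j k x y z = triple_count (PC q) R i j k x' y' z'"
proof -
  obtain \<sigma> where "\<sigma> \<in> U3 q" "x = \<sigma> ` x'" "y = \<sigma> ` y'" "z = \<sigma> ` z'"
    using assms(5,6) by (auto simp: R_eq[OF assms(4)] orbit3_def act3_def)
  then show ?thesis using triple_count_act assms by simp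
qed

text \<open>Counts are constant on orbits and \<open>R l\<close> contains \<open>base l\<close>, so
  the description in \<open>inum\<close> denotes the count at that one triple.\<close>

lemma inum_eq:
  assumes "i \<in> {0..q+4}" "j \<in> {0..q+4}" "k \<in> {0..q+4}" "l \<in> {0..q+4}" "base l = (x, y, z)"
  shows "inum (PC q) R i j k l = triple_count (PC q) R i j k x y z"
  unfolding inum_def
proof (rule the_equality)
  show "\<forall>(x', y', z')\<in>R l. triple_count (PC q) R i j k x' y' z' = triple_count (PC q) R i j k x y z"
    using triple_count_base assms by blast
next
  fix n assume "\<forall>(x', y', z')\<in>R l. triple_count (PC q) R i j k x' y' z' = n"
  then show "n = triple_count (PC q) R i j k x y z"
    using base_in_R[OF assms(4)] assms(5) by auto
qed

lemma valency_act:
  assumes "i \<in> {0..q+4}" "\<sigma> \<in> U3 q"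
  shows "card {\<omega> \<in> PC q. (\<sigma> ` x, \<sigma> ` y, \<omega>) \<in> R i} = card {\<omega> \<in> PC q. (x, y, \<omega>) \<in> R i}"
proof -
  have mem: "\<sigma> ` \<omega> \<in> {\<omega> \<in> PC q. (\<sigma> ` x, \<sigma> ` y, \<omega>) \<in> R i} \<longleftrightarrow> \<omega> \<in> {\<omega> \<in> PC q. (x, y, \<omega>) \<in> R i}" for \<omega>
    using assms by (simp add: act3_mem_R_iff U3_image_PC_iff)
  have "{\<omega> \<in> PC q. (\<sigma> ` x, \<sigma> ` y, \<omega>) \<in> R i} = image \<sigma> ` {\<omega> \<in> PC q. (x, y, \<omega>) \<in> R i}"
  proof (intro equalityI subsetI)
    fix \<omega> assume "\<omega> \<in> {\<omega> \<in> PC q. (\<sigma> ` x, \<sigma> ` y, \<omega>) \<in> R i}"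
    then have "inv \<sigma> ` \<omega> \<in> {\<omega> \<in> PC q. (x, y, \<omega>) \<in> R i}"
      using mem[of "inv \<sigma> ` \<omega>"] assms(2) by (simp only: U3_image_inv)
    then show "\<omega> \<in> image \<sigma> ` {\<omega> \<in> PC q. (x, y, \<omega>) \<in> R i}"
      by (rule rev_image_eqI) (simp only: U3_image_inv[OF assms(2)])
  qed (use mem in blast)
  then show ?thesis
    using assms(2) by (simp add: card_image inj_on_def U3_image_eq_iff)
qed

lemma orbits_eq: "{orbit3 q T | T. T \<in> PC q \<times> PC q \<times> PC q} = R ` {0..q+4}"
proof (intro equalityI subsetI)
  fix X :: "(('a ^ 3) set \<times> ('a ^ 3) set \<times> ('a ^ 3) set) set"
  assume "X \<in> {orbit3 q T | T. T \<in> PC q \<times> PC q \<times> PC q}"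
  then obtain T where T: "T \<in> PC q \<times> PC q \<times> PC q" "X = orbit3 q T" by blast
  obtain l where "l \<in> {0..q+4}" "T \<in> R l" using R_cover[OF T(1)] .
  then have "X = R l" unfolding T by (simp add: R_eq orbit3_eq)
  then show "X \<in> R ` {0..q+4}" using \<open>l \<in> {0..q+4}\<close> by blast
next
  fix X assume "X \<in> R ` {0..q+4}"
  then obtain l where "l \<in> {0..q+4}" "X = orbit3 q (base l)" using R_eq by blast
  then show "X \<in> {orbit3 q T | T. T \<in> PC q \<times> PC q \<times> PC q}" using base_PC by blast
qed

lemma is_AST: "AST (PC q) (q + 4) R"
  unfolding AST_def
proof (intro conjI)
  have *: "4 \<in> {4..q+4}" by simp
  have "{E1, E2, pt (d 4) (c 4)} \<subseteq> PC q" using d_iso[OF *] by simp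
  then have "card {E1, E2, pt (d 4) (c 4)} \<le> card (PC q :: ('a ^ 3) set set)"
    by (intro card_mono) auto
  then show "3 \<le> card (PC q :: ('a ^ 3) set set)" using d_ne_0[OF *] by simp
  show "inj_on R {0..q + 4}"
    by (rule inj_onI) (metis R_disjoint base_in_R)
  show "partition_on (PC q \<times> PC q \<times> PC q) (R ` {0..q + 4})"
  proof (rule partition_onI)
    show "\<Union> (R ` {0..q + 4}) = PC q \<times> PC q \<times> PC q"
    proof (intro equalityI subsetI)
      fix T :: "('a ^ 3) set \<times> ('a ^ 3) set \<times> ('a ^ 3) set"
      assume "T \<in> PC q \<times> PC q \<times> PC q"
      then obtain l where "l \<in> {0..q+4}" "T \<in> R l" by (rule R_cover)
      then show "T \<in> \<Union> (R ` {0..q + 4})" by (rule UN_I)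
    qed (elim UN_E, rule subsetD[OF R_subset])
    show "disjnt X Y" if "X \<in> R ` {0..q + 4}" "Y \<in> R ` {0..q + 4}" "X \<noteq> Y" for X Y
      using that R_disjoint unfolding disjnt_def by blast
    show "{} \<notin> R ` {0..q + 4}" using base_in_R by blast
  qed
  show "\<forall>i\<in>{0..q + 4}. \<exists>n. \<forall>x\<in>PC q. \<forall>y\<in>PC q. x \<noteq> y \<longrightarrow> card {\<omega> \<in> PC q. (x, y, \<omega>) \<in> R i} = n"
  proof (intro ballI exI impI)
    fix i and x y :: "('a ^ 3) set" assume i: "i \<in> {0..q + 4}" and xy: "x \<in> PC q" "y \<in> PC q" "x \<noteq> y"
    obtain \<sigma> where "\<sigma> \<in> U3 q" "\<sigma> ` E1 = x" "\<sigma> ` E2 = y" using two_transitive[OF xy] .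
    then show "card {\<omega> \<in> PC q. (x, y, \<omega>) \<in> R i} = card {\<omega> \<in> PC q. (E1, E2, \<omega>) \<in> R i}"
      using valency_act[OF i, of \<sigma> E1 E2] by simp
  qed
  show "\<forall>i\<in>{0..q+4}. \<forall>j\<in>{0..q+4}. \<forall>k\<in>{0..q+4}. \<forall>l\<in>{0..q+4}.
      \<exists>n. \<forall>(x, y, z)\<in>R l. triple_count (PC q) R i j k x y z = n"
  proof (intro ballI)
    fix i j k l assume *: "i \<in> {0..q+4}" "j \<in> {0..q+4}" "k \<in> {0..q+4}" "l \<in> {0..q+4}"
    obtain x y z where "base l = (x, y, z)" by (cases "base l")
    then show "\<exists>n. \<forall>(x, y, z)\<in>R l. triple_count (PC q) R i j k x y z = n"
      using triple_count_base[OF *]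
      by (intro exI[of _ "triple_count (PC q) R i j k x y z"]) auto
  qed
  show "\<forall>i\<in>{0..q+4}. \<forall>\<pi>. \<pi> permutes {0, 1, 2} \<longrightarrow> (\<exists>j\<in>{0..q+4}. permute_triple \<pi> ` R i = R j)"
  proof (intro ballI allI impI)
    fix i and \<pi> :: "nat \<Rightarrow> nat" assume i: "i \<in> {0..q+4}"
    have "permute_triple \<pi> (base i) \<in> PC q \<times> PC q \<times> PC q"
      using base_PC[OF i] by (cases "base i") (auto simp: permute_triple_def)
    then obtain j where j: "j \<in> {0..q+4}" "permute_triple \<pi> (base i) \<in> R j" using R_cover by metis
    \<comment> \<open>Permuting coordinates commutes with the group action, so a permuted orbit is
      the orbit of the permuted base triple.\<close>
    then have "permute_triple \<pi> ` R i = R j"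
      using i by (simp add: R_eq permute_triple_orbit3 orbit3_eq)
    then show "\<exists>j\<in>{0..q+4}. permute_triple \<pi> ` R i = R j" using j by blast
  qed
qed (rule R0 R1 R2 R3 finite_PC le_add2)+

end

section \<open>Counting points\<close>

context unitary_scheme
begin

abbreviation p :: "nat \<Rightarrow> nat \<Rightarrow> nat \<Rightarrow> nat \<Rightarrow> nat" where "p \<equiv> inum (PC q) R"

lemma range_4_0: "i \<in> {4..q+4} \<Longrightarrow> i \<in> {0..q+4}"
  by simp

lemma R_iff_triangle:
  assumes "i \<in> {4..q+4}" "x \<noteq> 0" "y \<noteq> 0" "z \<noteq> 0" "B x x = 0" "B y y = 0" "B z z = 0"
  shows "(line x, line y, line z) \<in> R i \<longleftrightarrow> triangle x y z \<asymp> d i"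
  using assms by (simp add: R_orbit orbit_iff_triangle_sim d_iso d_ne_0)

lemma R_standard_iff:
  assumes "i \<in> {4..q+4}"
  shows "(E1, E2, pt \<beta> \<gamma>) \<in> R i \<longleftrightarrow> iso \<beta> \<gamma> \<and> \<beta> \<asymp> d i"
  using assms by (simp add: R_orbit standard_orbit_iff d_iso d_ne_0)

text \<open>The right sides are the values of \<open>triangle\<close> at the normalised vectors. In
  the last one the form takes its arguments in the opposite order, hence the outer
  conjugation.\<close>

lemma R_pt_iff:
  assumes "i \<in> {4..q+4}" "iso \<beta> \<gamma>"
  shows "(pt \<beta> \<gamma>, E2, E1) \<in> R i \<longleftrightarrow> cj \<beta> \<asymp> d i"
    and "(E1, pt \<beta> \<gamma>, E2) \<in> R i \<longleftrightarrow> cj \<beta> \<asymp> d i"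
    and "(pt \<beta> \<gamma>, E1, E2) \<in> R i \<longleftrightarrow> \<beta> \<asymp> d i"
    and "iso \<beta>' \<gamma>' \<Longrightarrow>
      (E1, pt \<beta> \<gamma>, pt \<beta>' \<gamma>') \<in> R i \<longleftrightarrow> \<beta>' + cj \<beta> + \<gamma>' * cj \<gamma> \<asymp> d i"
    and "iso \<beta>' \<gamma>' \<Longrightarrow>
      (pt \<beta> \<gamma>, E2, pt \<beta>' \<gamma>') \<in> R i \<longleftrightarrow>
      cj \<beta> * \<beta>' * cj (\<beta>' + cj \<beta> + \<gamma>' * cj \<gamma>) \<asymp> d i"
  using assms R_iff_triangle[OF assms(1), of "vector [\<beta>, 1, \<gamma>]" "vector [0, 1, 0]" "vector [1, 0, 0]"]
    R_iff_triangle[OF assms(1), of "vector [1, 0, 0]" "vector [\<beta>, 1, \<gamma>]" "vector [0, 1, 0]"]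
    R_iff_triangle[OF assms(1), of "vector [\<beta>, 1, \<gamma>]" "vector [1, 0, 0]" "vector [0, 1, 0]"]
    R_iff_triangle[OF assms(1), of "vector [1, 0, 0]" "vector [\<beta>, 1, \<gamma>]" "vector [\<beta>', 1, \<gamma>']"]
    R_iff_triangle[OF assms(1), of "vector [\<beta>, 1, \<gamma>]" "vector [0, 1, 0]" "vector [\<beta>', 1, \<gamma>']"]
  by (simp_all add: triangle_def iso_def add_ac mult_ac flip: E1_def pt_def)

text \<open>The chart misses only \<open>E1\<close>. In each use one of the conditions puts the
  counted line and \<open>E1\<close> into a triple of distinct lines, so \<open>E1\<close> does not
  count.\<close>

lemma card_PC_eq_card_pairs:
  assumes "\<not> P E1"
  shows "card {\<omega> \<in> PC q. P \<omega>} = card {(\<beta>, \<gamma>). iso \<beta> \<gamma> \<and> P (pt \<beta> \<gamma>)}"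
proof -
  have "{\<omega> \<in> PC q. P \<omega>} = (\<lambda>(\<beta>, \<gamma>). pt \<beta> \<gamma>) ` {(\<beta>, \<gamma>). iso \<beta> \<gamma> \<and> P (pt \<beta> \<gamma>)}"
  proof (intro equalityI subsetI)
    fix \<omega> assume "\<omega> \<in> {\<omega> \<in> PC q. P \<omega>}"
    then have w: "\<omega> \<in> PC q" "P \<omega>" by simp_all
    from w(1) show "\<omega> \<in> (\<lambda>(\<beta>, \<gamma>). pt \<beta> \<gamma>) ` {(\<beta>, \<gamma>). iso \<beta> \<gamma> \<and> P (pt \<beta> \<gamma>)}"
    proof (cases rule: PC_cases)
      case 1
      then show ?thesis using assms w by simp
    next
      case (2 \<beta> \<gamma>)
      then show ?thesis using w by (intro rev_image_eqI[of "(\<beta>, \<gamma>)"]) simp_all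
    qed
  qed clarsimp
  moreover have "inj_on (\<lambda>(\<beta>, \<gamma>). pt \<beta> \<gamma>) {(\<beta>, \<gamma>). iso \<beta> \<gamma> \<and> P (pt \<beta> \<gamma>)}"
    by (rule inj_onI) clarsimp
  ultimately show ?thesis by (simp add: card_image)
qed

section \<open>The trace-zero class and the points over one class\<close>

lemma trace_d_4: "d 4 + cj (d 4) = 0"
  using d_iso[of 4] c_4 by (simp add: iso_def)

text \<open>Vanishing of the trace is constant on classes, and all nonzero elements of trace zero
  are equivalent to \<open>d 4\<close>.\<close>

lemma class_4_iff:
  assumes "i \<in> {4..q+4}" "x \<asymp> d i"
  shows "i = 4 \<longleftrightarrow> x + cj x = 0"
proof
  assume "x + cj x = 0"
  then have "x \<asymp> d 4" using assms trace_d_4 d_ne_0[of 4] by (intro trace_eq_0_imp_sim) (auto simp: sim_def)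
  then have "d i \<asymp> d 4" using assms sim_cong by blast
  then show "i = 4" using d_unique[of i 4] assms by simp
qed (use assms trace_d_4 trace_eq_0_sim in auto)

lemma trace_d_ne_0: "i \<in> {5..q+4} \<Longrightarrow> d i + cj (d i) \<noteq> 0"
  using class_4_iff[of i "d i"] d_ne_0[of i] by auto

text \<open>There are q - 1 choices of \<beta>, each with 1 or q + 1 choices of \<gamma> according
  to whether the trace of the class vanishes.\<close>

lemma card_iso_class:
  assumes "i \<in> {4..q+4}"
  shows "card {(\<beta>, \<gamma>). iso \<beta> \<gamma> \<and> \<beta> \<asymp> d i} = (if i = 4 then q - 1 else q\<^sup>2 - 1)"
proof -
  have "{(\<beta>, \<gamma>). iso \<beta> \<gamma> \<and> \<beta> \<asymp> d i} = Sigma {\<beta>. \<beta> \<asymp> d i} (\<lambda>\<beta>. {\<gamma>. iso \<beta> \<gamma>})" by auto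
  then have "card {(\<beta>, \<gamma>). iso \<beta> \<gamma> \<and> \<beta> \<asymp> d i} = (\<Sum>\<beta>\<in>{\<beta>. \<beta> \<asymp> d i}. card {\<gamma>. iso \<beta> \<gamma>})"
    by simp
  also have "\<dots> = (\<Sum>\<beta>\<in>{\<beta>. \<beta> \<asymp> d i}. if i = 4 then 1 else q + 1)"
    using class_4_iff[OF assms] by (intro sum.cong) (auto simp: card_iso_fibre)
  also have "\<dots> = (q - 1) * (if i = 4 then 1 else q + 1)"
    by (simp add: card_sim_class[OF d_ne_0[OF assms]])
  also have "\<dots> = (if i = 4 then q - 1 else q\<^sup>2 - 1)"
    by (simp add: power2_eq_square algebra_simps diff_mult_distrib)
  finally show ?thesis .
qed

text \<open>The extra condition is constant on the class of \<open>d i\<close>, so it keeps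
  everything or nothing.\<close>

lemma card_iso_class_cj:
  assumes "i \<in> {4..q+4}"
  shows "card {(\<beta>, \<gamma>). iso \<beta> \<gamma> \<and> \<beta> \<asymp> d i \<and> cj \<beta> \<asymp> x} =
    (if cj (d i) \<asymp> x then if i = 4 then q - 1 else q\<^sup>2 - 1 else 0)"
proof -
  have "cj \<beta> \<asymp> x \<longleftrightarrow> cj (d i) \<asymp> x" if "\<beta> \<asymp> d i" for \<beta>
    using that by (intro sim_cong) simp
  then have "{(\<beta>, \<gamma>). iso \<beta> \<gamma> \<and> \<beta> \<asymp> d i \<and> cj \<beta> \<asymp> x} =
      (if cj (d i) \<asymp> x then {(\<beta>, \<gamma>). iso \<beta> \<gamma> \<and> \<beta> \<asymp> d i} else {})" by auto
  then show ?thesis using card_iso_class[OF assms] by simp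
qed

text \<open>Two entries of the base triple coincide, so one condition is a trivial relation and only
  separates the counted line from a base line. The other two place \<open>\<beta>\<close> and
  \<open>cj \<beta>\<close> in given classes.\<close>

lemma p_degenerate:
  assumes i: "i \<in> {4..q+4}" and j: "j \<in> {4..q+4}"
  shows p_1: "p 1 j i 1 = (if cj (d i) \<asymp> d j then if i = 4 then q - 1 else q\<^sup>2 - 1 else 0)"
    and p_2: "p j 2 i 2 = (if cj (d i) \<asymp> d j then if i = 4 then q - 1 else q\<^sup>2 - 1 else 0)"
    and p_3: "p j i 3 3 = (if cj (d j) \<asymp> d i then if j = 4 then q - 1 else q\<^sup>2 - 1 else 0)"
proof -
  note r = range_4_0[OF i] range_4_0[OF j]
  have "p 1 j i 1 = triple_count (PC q) R 1 j i E1 E2 E2"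
    using r by (intro inum_eq) (simp_all add: base_def)
  also have "\<dots> = card {(\<beta>, \<gamma>). iso \<beta> \<gamma> \<and>
      (pt \<beta> \<gamma>, E2, E2) \<in> R 1 \<and> (E1, pt \<beta> \<gamma>, E2) \<in> R j \<and> (E1, E2, pt \<beta> \<gamma>) \<in> R i}"
    unfolding triple_count_def
    by (rule card_PC_eq_card_pairs) (use R_distinct[OF i] in blast)
  also have "\<dots> = card {(\<beta>, \<gamma>). iso \<beta> \<gamma> \<and> \<beta> \<asymp> d i \<and> cj \<beta> \<asymp> d j}"
  proof -
    have "(pt \<beta> \<gamma>, E2, E2) \<in> R 1" if "iso \<beta> \<gamma>" "\<beta> \<asymp> d i" for \<beta> \<gamma>
      unfolding R1 using that by (auto simp: sim_def)
    then show ?thesis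
      using i j by (intro arg_cong[where f = card] Collect_cong) (auto simp: R_standard_iff R_pt_iff)
  qed
  finally show "p 1 j i 1 = (if cj (d i) \<asymp> d j then if i = 4 then q - 1 else q\<^sup>2 - 1 else 0)"
    using card_iso_class_cj[OF i] by simp
  have "p j 2 i 2 = triple_count (PC q) R j 2 i E1 E2 E1"
    using r by (intro inum_eq) (simp_all add: base_def)
  also have "\<dots> = card {(\<beta>, \<gamma>). iso \<beta> \<gamma> \<and>
      (pt \<beta> \<gamma>, E2, E1) \<in> R j \<and> (E1, pt \<beta> \<gamma>, E1) \<in> R 2 \<and> (E1, E2, pt \<beta> \<gamma>) \<in> R i}"
    unfolding triple_count_def
    by (rule card_PC_eq_card_pairs) (use R_distinct[OF i] in blast)
  also have "\<dots> = card {(\<beta>, \<gamma>). iso \<beta> \<gamma> \<and> \<beta> \<asymp> d i \<and> cj \<beta> \<asymp> d j}"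
  proof -
    have "(E1, pt \<beta> \<gamma>, E1) \<in> R 2" if "iso \<beta> \<gamma>" for \<beta> \<gamma>
      unfolding R2 using that by auto
    then show ?thesis
      using i j by (intro arg_cong[where f = card] Collect_cong) (auto simp: R_standard_iff R_pt_iff)
  qed
  finally show "p j 2 i 2 = (if cj (d i) \<asymp> d j then if i = 4 then q - 1 else q\<^sup>2 - 1 else 0)"
    using card_iso_class_cj[OF i] by simp
  \<comment> \<open>The roles change here: \<open>(pt \<beta> \<gamma>, E1, E2)\<close> is a cyclic
    shift of standard position, so \<open>j\<close> fixes the class of \<open>\<beta>\<close> and
    \<open>i\<close> that of its conjugate.\<close>
  have "p j i 3 3 = triple_count (PC q) R j i 3 E1 E1 E2"
    using r by (intro inum_eq) (simp_all add: base_def)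
  also have "\<dots> = card {(\<beta>, \<gamma>). iso \<beta> \<gamma> \<and>
      (pt \<beta> \<gamma>, E1, E2) \<in> R j \<and> (E1, pt \<beta> \<gamma>, E2) \<in> R i \<and> (E1, E1, pt \<beta> \<gamma>) \<in> R 3}"
    unfolding triple_count_def
    by (rule card_PC_eq_card_pairs) (use R_distinct[OF j] in blast)
  also have "\<dots> = card {(\<beta>, \<gamma>). iso \<beta> \<gamma> \<and> \<beta> \<asymp> d j \<and> cj \<beta> \<asymp> d i}"
  proof -
    have "(E1, E1, pt \<beta> \<gamma>) \<in> R 3" if "iso \<beta> \<gamma>" for \<beta> \<gamma>
      unfolding R3 using that by auto
    then show ?thesis
      using i j by (intro arg_cong[where f = card] Collect_cong) (auto simp: R_standard_iff R_pt_iff)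
  qed
  finally show "p j i 3 3 = (if cj (d j) \<asymp> d i then if j = 4 then q - 1 else q\<^sup>2 - 1 else 0)"
    using card_iso_class_cj[OF j] by simp
qed

text \<open>The value of the form on the representatives of \<open>pt (d l) (c l)\<close> and \<open>pt \<beta> \<gamma>\<close>.\<close>

definition X :: "nat \<Rightarrow> 'a \<Rightarrow> 'a \<Rightarrow> 'a" where
  "X l \<beta> \<gamma> = cj \<beta> + d l + cj \<gamma> * c l"

definition sol :: "nat \<Rightarrow> nat \<Rightarrow> nat \<Rightarrow> nat \<Rightarrow> 'a \<Rightarrow> 'a \<Rightarrow> bool" where
  "sol i j k l \<beta> \<gamma> \<longleftrightarrow>
     iso \<beta> \<gamma> \<and> \<beta> \<asymp> d k \<and> X l \<beta> \<gamma> \<asymp> d j \<and> cj \<beta> * d l * cj (X l \<beta> \<gamma>) \<asymp> d i"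

lemma p_eq_card_sol:
  assumes "i \<in> {4..q+4}" "j \<in> {4..q+4}" "k \<in> {4..q+4}" "l \<in> {4..q+4}"
  shows "p i j k l = card {(\<beta>, \<gamma>). sol i j k l \<beta> \<gamma>}"
proof -
  have "p i j k l = triple_count (PC q) R i j k E1 E2 (pt (d l) (c l))"
    using assms by (intro inum_eq) (auto simp: base_def)
  also have "\<dots> = card {(\<beta>, \<gamma>). iso \<beta> \<gamma> \<and> (pt \<beta> \<gamma>, E2, pt (d l) (c l)) \<in> R i \<and>
      (E1, pt \<beta> \<gamma>, pt (d l) (c l)) \<in> R j \<and> (E1, E2, pt \<beta> \<gamma>) \<in> R k}"
    unfolding triple_count_def
    by (rule card_PC_eq_card_pairs) (use R_distinct[OF assms(3)] in blast)
  also have "\<dots> = card {(\<beta>, \<gamma>). sol i j k l \<beta> \<gamma>}"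
    using assms d_iso[OF assms(4)]
    by (intro arg_cong[where f = card] Collect_cong)
      (auto simp: sol_def X_def R_standard_iff R_pt_iff add_ac mult_ac)
  finally show ?thesis .
qed

lemma trace_X:
  assumes "l \<in> {4..q+4}" "iso \<beta> \<gamma>"
  shows "X l \<beta> \<gamma> + cj (X l \<beta> \<gamma>) = 0 \<longleftrightarrow> \<gamma> = c l"
proof -
  have "X l \<beta> \<gamma> + cj (X l \<beta> \<gamma>) = - ((c l - \<gamma>) * cj (c l - \<gamma>))"
    using trace_iso[OF d_iso[OF assms(1)] assms(2)] by (simp add: X_def add_ac mult_ac)
  then show ?thesis by (metis cj_eq_0_iff eq_iff_diff_eq_0 mult_eq_0_iff neg_equal_0_iff_equal)
qed

text \<open>The element is \<open>triangle\<close> of the representatives of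
  \<open>pt \<beta> \<gamma>\<close>, \<open>E2\<close> and \<open>pt (d l) (c l)\<close>. Its trace
  is minus the norm of their determinant, which is \<open>d l * \<gamma> - \<beta> * c l\<close> up
  to sign.\<close>

lemma trace_X':
  assumes "l \<in> {4..q+4}" "iso \<beta> \<gamma>"
  shows "cj \<beta> * d l * cj (X l \<beta> \<gamma>) + cj (cj \<beta> * d l * cj (X l \<beta> \<gamma>)) = 0 \<longleftrightarrow> d l * \<gamma> = \<beta> * c l"
proof -
  have "cj \<beta> * d l * cj (X l \<beta> \<gamma>) + cj (cj \<beta> * d l * cj (X l \<beta> \<gamma>)) =
      - ((d l * \<gamma> - \<beta> * c l) * cj (d l * \<gamma> - \<beta> * c l))"
    using d_iso[OF assms(1)] assms(2) by (simp add: X_def iso_def) algebra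
  then show ?thesis by (metis cj_eq_0_iff eq_iff_diff_eq_0 mult_eq_0_iff neg_equal_0_iff_equal)
qed

text \<open>Each of the three equations says that the new line is coplanar with one pair of the base
  triple.\<close>

lemma sol_class_4:
  assumes "sol i j k l \<beta> \<gamma>" "i \<in> {4..q+4}" "j \<in> {4..q+4}" "k \<in> {4..q+4}" "l \<in> {4..q+4}"
  shows "k = 4 \<longleftrightarrow> \<gamma> = 0" "j = 4 \<longleftrightarrow> \<gamma> = c l" "i = 4 \<longleftrightarrow> d l * \<gamma> = \<beta> * c l"
    "\<beta> \<noteq> 0" "X l \<beta> \<gamma> \<noteq> 0" "iso \<beta> \<gamma>"
proof -
  have s: "iso \<beta> \<gamma>" "\<beta> \<asymp> d k" "X l \<beta> \<gamma> \<asymp> d j" "cj \<beta> * d l * cj (X l \<beta> \<gamma>) \<asymp> d i"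
    using assms(1) by (simp_all add: sol_def)
  have "\<beta> + cj \<beta> = 0 \<longleftrightarrow> \<gamma> = 0"
    using s(1) by (auto simp: iso_def)
  then show "k = 4 \<longleftrightarrow> \<gamma> = 0" using class_4_iff s assms by blast
  show "j = 4 \<longleftrightarrow> \<gamma> = c l" using class_4_iff trace_X s assms by blast
  show "i = 4 \<longleftrightarrow> d l * \<gamma> = \<beta> * c l" using class_4_iff trace_X' s assms by blast
  show "\<beta> \<noteq> 0" "X l \<beta> \<gamma> \<noteq> 0" "iso \<beta> \<gamma>" using s by (simp_all add: sim_def)
qed

lemma c_ne_0: "l \<in> {5..q+4} \<Longrightarrow> c l \<noteq> 0"
  using d_iso[of l] trace_d_ne_0[of l] by (auto simp: iso_def)

text \<open>With \<open>c 4 = 0\<close> all three equations of \<open>sol_class_4\<close> become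
  \<open>\<gamma> = 0\<close>.\<close>

lemma sol_superscript_4:
  assumes "sol i j k 4 \<beta> \<gamma>" "i \<in> {4..q+4}" "j \<in> {4..q+4}" "k \<in> {4..q+4}"
  shows "i = 4 \<longleftrightarrow> k = 4" "j = 4 \<longleftrightarrow> k = 4"
  using sol_class_4[OF assms] c_4 d_ne_0[of 4] by auto

text \<open>Two of the equations in \<open>sol_class_4\<close> leave only a base line:
  \<open>\<gamma> = 0\<close> together with either other one contradicts
  \<open>c l \<noteq> 0\<close>, and the other two force the point \<open>pt (d l) (c l)\<close>,
  where \<open>X\<close> vanishes.\<close>

lemma sol_two_4:
  assumes s: "sol i j k l \<beta> \<gamma>" and "i \<in> {4..q+4}" "j \<in> {4..q+4}" "k \<in> {4..q+4}"
    and l: "l \<in> {5..q+4}"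
  shows "\<not> (j = 4 \<and> k = 4)" "\<not> (i = 4 \<and> k = 4)" "\<not> (i = 4 \<and> j = 4)"
proof -
  have l4: "l \<in> {4..q+4}" using l by simp
  note * = sol_class_4[OF assms(1-4) l4] c_ne_0[OF l] d_ne_0[OF l4] d_iso[OF l4]
  show "\<not> (j = 4 \<and> k = 4)" "\<not> (i = 4 \<and> k = 4)" using * by auto
  show "\<not> (i = 4 \<and> j = 4)"
  proof
    assume "i = 4 \<and> j = 4"
    then have "\<gamma> = c l" "\<beta> = d l" using * by (auto simp: mult.commute)
    then have "X l \<beta> \<gamma> = 0" using *(9) by (simp add: X_def iso_def add_ac mult_ac)
    then show False using * by simp
  qed
qed

section \<open>Values of the intersection numbers\<close>

lemma card_sol_1:
  assumes "\<And>\<beta> \<gamma> \<beta>' \<gamma>'. sol i j k l \<beta> \<gamma> \<Longrightarrow> sol i j k l \<beta>' \<gamma>' \<Longrightarrow> \<beta> = \<beta>' \<and> \<gamma> = \<gamma>'"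
  shows "card {(\<beta>, \<gamma>). sol i j k l \<beta> \<gamma>} = (if \<exists>\<beta> \<gamma>. sol i j k l \<beta> \<gamma> then 1 else 0)"
proof (cases "\<exists>\<beta> \<gamma>. sol i j k l \<beta> \<gamma>")
  case True
  then obtain \<beta> \<gamma> where "sol i j k l \<beta> \<gamma>" by blast
  then have "{(\<beta>, \<gamma>). sol i j k l \<beta> \<gamma>} = {(\<beta>, \<gamma>)}" using assms by auto
  then show ?thesis using True by simp
qed simp

text \<open>Here \<beta> runs through the class of \<open>d 4\<close> with
  \<open>\<gamma> = 0\<close>; only \<open>d 4\<close> itself drops out, because it gives the third
  base line and \<open>X\<close> vanishes there.\<close>

lemma p_444_4: "p 4 4 4 4 = q - 2"
proof -
  have r: "4 \<in> {4..q+4}" by simp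
  have "sol 4 4 4 4 \<beta> \<gamma> \<longleftrightarrow> \<gamma> = 0 \<and> \<beta> \<asymp> d 4 \<and> \<beta> \<noteq> d 4" for \<beta> \<gamma>
  proof
    assume s: "sol 4 4 4 4 \<beta> \<gamma>"
    note * = sol_class_4[OF s r r r r]
    have "\<beta> \<noteq> d 4"
    proof
      assume "\<beta> = d 4"
      then have "X 4 \<beta> \<gamma> = 0" using trace_d_4 c_4 by (simp add: X_def add.commute)
      then show False using * by simp
    qed
    then show "\<gamma> = 0 \<and> \<beta> \<asymp> d 4 \<and> \<beta> \<noteq> d 4" using * s by (simp add: sol_def)
  next
    assume *: "\<gamma> = 0 \<and> \<beta> \<asymp> d 4 \<and> \<beta> \<noteq> d 4"
    then have b: "\<beta> + cj \<beta> = 0" using class_4_iff[OF r] by blast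
    then have i: "iso \<beta> \<gamma>" using * by (simp add: iso_def)
    have "cj \<beta> = - \<beta>" using b by (simp add: add_eq_0_iff)
    then have X: "X 4 \<beta> \<gamma> \<noteq> 0" using * c_4 by (auto simp: X_def)
    have "X 4 \<beta> \<gamma> \<asymp> d 4"
      using trace_X[OF r i] * c_4 X trace_d_4 d_ne_0[OF r] by (intro trace_eq_0_imp_sim) auto
    moreover have "cj \<beta> * d 4 * cj (X 4 \<beta> \<gamma>) \<asymp> d 4"
      using trace_X'[OF r i] * c_4 X trace_d_4 d_ne_0[OF r]
      by (intro trace_eq_0_imp_sim) (auto simp: sim_def)
    ultimately show "sol 4 4 4 4 \<beta> \<gamma>" using i * by (simp add: sol_def)
  qed
  then have "{(\<beta>, \<gamma>). sol 4 4 4 4 \<beta> \<gamma>} = (\<lambda>\<beta>. (\<beta>, 0)) ` ({\<beta>. \<beta> \<asymp> d 4} - {d 4})" by auto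
  then have "p 4 4 4 4 = card ({\<beta>. \<beta> \<asymp> d 4} - {d 4})"
    by (simp add: p_eq_card_sol[OF r r r r] card_image inj_on_def)
  also have "\<dots> = q - 2"
    using card_sim_class[OF d_ne_0[OF r]] d_ne_0[OF r] by (subst card_Diff_subset) auto
  finally show ?thesis .
qed

text \<open>As \<open>c 4 = 0\<close>, apart from isotropy only \<beta> is restricted. It is unique
  because \<open>(cj \<beta> + d 4) + (- cj \<beta>) = d 4\<close> decomposes \<open>d 4\<close>
  over two distinct classes; its trace is nonzero, so q + 1 values of \<gamma> go with it.\<close>

lemma p_ijk_4:
  assumes "i \<in> {5..q+4}" "j \<in> {5..q+4}" "k \<in> {5..q+4}"
  shows "p i j k 4 = (if \<exists>\<beta> \<gamma>. sol i j k 4 \<beta> \<gamma> then q + 1 else 0)"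
proof (cases "\<exists>\<beta> \<gamma>. sol i j k 4 \<beta> \<gamma>")
  case True
  have r: "i \<in> {4..q+4}" "j \<in> {4..q+4}" "k \<in> {4..q+4}" "4 \<in> {4..q+4}" using assms by auto
  obtain \<beta> \<gamma> where s: "sol i j k 4 \<beta> \<gamma>" using True by blast
  have s_iff: "sol i j k 4 \<beta>' \<gamma>' \<longleftrightarrow> iso \<beta>' \<gamma>' \<and> \<beta>' \<asymp> d k \<and>
      cj \<beta>' + d 4 \<asymp> d j \<and> cj \<beta>' * d 4 * cj (cj \<beta>' + d 4) \<asymp> d i" for \<beta>' \<gamma>'
    by (simp add: sol_def X_def c_4)
  have uniq: "\<beta>' = \<beta>" if "sol i j k 4 \<beta>' \<gamma>'" for \<beta>' \<gamma>'
  proof -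
    have 1: "cj \<beta> + d 4 \<asymp> d j" "cj \<beta>' + d 4 \<asymp> d j" "- cj \<beta> \<asymp> cj (d k)" "- cj \<beta>' \<asymp> cj (d k)"
      using s that by (simp_all add: s_iff)
    \<comment> \<open>If the classes agreed, the sum \<open>d 4\<close> would lie in the class of
      \<open>d j\<close>, contrary to the choice of \<open>j\<close>.\<close>
    have "\<not> d j \<asymp> cj (d k)"
    proof
      assume "d j \<asymp> cj (d k)"
      then have "- cj \<beta> \<asymp> d j" using 1(3) sim_cong2 by blast
      then have "d 4 \<asymp> d j" using sim_add[OF 1(1), of "- cj \<beta>"] d_ne_0[of 4] by simp
      then show False using d_unique[of 4 j] r assms by simp
    qed
    then have "- cj \<beta>' = - cj \<beta>"
      using sim_sum_unique(2)[OF 1(2,1,4,3)] by simp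
    then show ?thesis by simp
  qed
  have "sol i j k 4 \<beta>' \<gamma>' \<longleftrightarrow> \<beta>' = \<beta> \<and> iso \<beta> \<gamma>'" for \<beta>' \<gamma>'
  proof
    assume *: "sol i j k 4 \<beta>' \<gamma>'"
    from uniq[OF *] * show "\<beta>' = \<beta> \<and> iso \<beta> \<gamma>'" by (simp add: s_iff)
  next
    assume "\<beta>' = \<beta> \<and> iso \<beta> \<gamma>'"
    with s show "sol i j k 4 \<beta>' \<gamma>'" by (simp add: s_iff)
  qed
  then have "{(\<beta>', \<gamma>'). sol i j k 4 \<beta>' \<gamma>'} = {\<beta>} \<times> {\<gamma>'. iso \<beta> \<gamma>'}"
    by auto
  moreover have "\<beta> + cj \<beta> \<noteq> 0" using class_4_iff[OF r(3), of \<beta>] s assms by (auto simp: s_iff)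
  ultimately have "p i j k 4 = q + 1"
    by (simp add: p_eq_card_sol[OF r] card_cartesian_product card_iso_fibre)
  then show ?thesis using True by simp
next
  case False
  then show ?thesis using assms by (subst p_eq_card_sol) auto
qed

text \<open>The index 4 expresses \<gamma> through \<beta>. Substituted into \<open>X\<close>, and
  with isotropy of the base point, this gives a decomposition of \<open>d l\<close> over the classes
  of \<open>d j\<close> and \<open>e\<close>, so \<beta> is unique once these classes
  differ.\<close>

lemma p_4jk:
  assumes "j \<in> {5..q+4}" "k \<in> {5..q+4}" "l \<in> {5..q+4}"
  shows "p 4 j k l = (if \<exists>\<beta> \<gamma>. sol 4 j k l \<beta> \<gamma> then 1 else 0)"
proof -
  have r: "4 \<in> {4..q+4}" "j \<in> {4..q+4}" "k \<in> {4..q+4}" "l \<in> {4..q+4}" using assms by auto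
  note l0 = d_ne_0[OF r(4)] d_iso[OF r(4), unfolded iso_def]
  \<comment> \<open>A representative for the class of the second summand
    \<open>cj \<beta> * d l / cj (d l)\<close>, which depends only on the class of \<beta>.\<close>
  define e where "e = cj (d k) * d l / cj (d l)"
  have sl: "X l \<beta> \<gamma> \<asymp> d j" "cj \<beta> * d l / cj (d l) \<asymp> e" "X l \<beta> \<gamma> + cj \<beta> * d l / cj (d l) = d l"
      "\<gamma> = \<beta> * c l / d l" "\<not> d j \<asymp> e"
    if s: "sol 4 j k l \<beta> \<gamma>" for \<beta> \<gamma>
  proof -
    note * = sol_class_4[OF s r]
    show 1: "X l \<beta> \<gamma> \<asymp> d j" using s by (simp add: sol_def)
    have "\<beta> \<asymp> d k" using s by (simp add: sol_def)
    then show 2: "cj \<beta> * d l / cj (d l) \<asymp> e"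
      unfolding e_def using l0(1) by (auto simp: sim_def mult_ac)
    show g: "\<gamma> = \<beta> * c l / d l" using * l0(1) by (simp add: field_simps)
    have "X l \<beta> \<gamma> = d l + cj \<beta> * (cj (d l) + c l * cj (c l)) / cj (d l)"
      using l0(1) unfolding X_def g by (simp add: field_simps)
    also have "cj (d l) + c l * cj (c l) = - d l" using l0(2) by (simp add: eq_neg_iff_add_eq_0 add_ac)
    finally show 3: "X l \<beta> \<gamma> + cj \<beta> * d l / cj (d l) = d l" by simp
    \<comment> \<open>If the classes agreed, \<open>d l\<close> would lie in them and \<beta> would
      be a fixed multiple of \<open>d l\<close>. Isotropy of both points makes that multiple 1, and
      then \<open>X\<close> vanishes.\<close>
    show "\<not> d j \<asymp> e"
    proof
      assume "d j \<asymp> e"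
      then have "X l \<beta> \<gamma> \<asymp> e" using 1 sim_trans by blast
      then have "d l \<asymp> e" using sim_add[OF _ 2, of "X l \<beta> \<gamma>", unfolded 3] l0(1) by simp
      then have "cj \<beta> * d l / cj (d l) \<asymp> d l" using 2 sim_cong2 by blast
      then have t: "\<beta> * cj (d l) = cj \<beta> * d l" using l0(1) by (auto simp: sim_def field_simps)
      have "\<beta> + cj \<beta> + \<gamma> * cj \<gamma> = 0" using *(6) by (simp add: iso_def)
      then have "(\<beta> + cj \<beta>) * d l * cj (d l) + \<beta> * cj \<beta> * (c l * cj (c l)) = 0"
        unfolding g using l0(1) by (simp add: field_simps)
      moreover have "c l * cj (c l) = - (d l + cj (d l))" using l0(2) by (simp add: add_eq_0_iff)
      ultimately have "(\<beta> + cj \<beta>) * d l * cj (d l) = \<beta> * cj \<beta> * (d l + cj (d l))" by algebra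
      moreover have "(\<beta> + cj \<beta>) * d l * cj (d l) = cj \<beta> * d l * (d l + cj (d l))"
        using t by algebra
      ultimately have "d l * (cj \<beta> * (d l + cj (d l))) = \<beta> * (cj \<beta> * (d l + cj (d l)))"
        by algebra
      then have "\<beta> = d l" using trace_d_ne_0[OF assms(3)] *(4) by simp
      then have "X l \<beta> \<gamma> = 0" using 3 l0(1) by simp
      then show False using * by simp
    qed
  qed
  have "\<beta> = \<beta>' \<and> \<gamma> = \<gamma>'" if s: "sol 4 j k l \<beta> \<gamma>" "sol 4 j k l \<beta>' \<gamma>'" for \<beta> \<gamma> \<beta>' \<gamma>'
  proof -
    have "cj \<beta> * d l / cj (d l) = cj \<beta>' * d l / cj (d l)"
      using sim_sum_unique(2)[OF sl(1)[OF s(1)] sl(1)[OF s(2)] sl(2)[OF s(1)] sl(2)[OF s(2)]]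
        sl(3)[OF s(1)] sl(3)[OF s(2)] sl(5)[OF s(1)] by simp
    then have "\<beta> = \<beta>'" using l0(1) by simp
    then show ?thesis using sl(4)[OF s(1)] sl(4)[OF s(2)] by simp
  qed
  then show ?thesis
    unfolding p_eq_card_sol[OF r] by (rule card_sol_1)
qed

text \<open>The index 4 fixes \<open>\<gamma> = c l\<close>, and isotropy then fixes the trace of
  \<beta>. In a class of nonzero trace an element is determined by its trace.\<close>

lemma p_i4k:
  assumes "i \<in> {5..q+4}" "k \<in> {5..q+4}" "l \<in> {5..q+4}"
  shows "p i 4 k l = (if \<exists>\<beta> \<gamma>. sol i 4 k l \<beta> \<gamma> then 1 else 0)"
proof -
  have r: "i \<in> {4..q+4}" "4 \<in> {4..q+4}" "k \<in> {4..q+4}" "l \<in> {4..q+4}" using assms by auto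
  have "\<beta> = \<beta>' \<and> \<gamma> = \<gamma>'" if s: "sol i 4 k l \<beta> \<gamma>" "sol i 4 k l \<beta>' \<gamma>'" for \<beta> \<gamma> \<beta>' \<gamma>'
  proof -
    note * = sol_class_4[OF s(1) r] sol_class_4[OF s(2) r]
    have g: "\<gamma> = c l" "\<gamma>' = c l" using * by simp_all
    have "\<beta> \<asymp> d k" "\<beta>' \<asymp> d k" using s by (simp_all add: sol_def)
    then obtain t t' where t: "\<beta> = t * d k" "\<beta>' = t' * d k" "cj t = t" "cj t' = t'"
      by (auto elim!: simE)
    have "\<beta> + cj \<beta> = \<beta>' + cj \<beta>'"
      using *(6,12) unfolding iso_def g by (metis add_right_cancel)
    then have "t * (d k + cj (d k)) = t' * (d k + cj (d k))"
      using t by (simp add: algebra_simps)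
    then show ?thesis using trace_d_ne_0[OF assms(2)] t g by simp
  qed
  then show ?thesis
    unfolding p_eq_card_sol[OF r] by (rule card_sol_1)
qed

text \<open>The index 4 gives \<open>\<gamma> = 0\<close>, so \<open>X\<close> and
  \<open>- cj \<beta>\<close> add up to \<open>d l\<close>. Their classes are those of
  \<open>d j\<close> and \<open>d 4\<close>, since the latter is closed under conjugation, and these
  are distinct.\<close>

lemma p_ij4:
  assumes "i \<in> {5..q+4}" "j \<in> {5..q+4}" "l \<in> {5..q+4}"
  shows "p i j 4 l = (if \<exists>\<beta> \<gamma>. sol i j 4 l \<beta> \<gamma> then 1 else 0)"
proof -
  have r: "i \<in> {4..q+4}" "j \<in> {4..q+4}" "4 \<in> {4..q+4}" "l \<in> {4..q+4}" using assms by auto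
  have "\<beta> = \<beta>' \<and> \<gamma> = \<gamma>'" if s: "sol i j 4 l \<beta> \<gamma>" "sol i j 4 l \<beta>' \<gamma>'" for \<beta> \<gamma> \<beta>' \<gamma>'
  proof -
    note * = sol_class_4[OF s(1) r] sol_class_4[OF s(2) r]
    have g: "\<gamma> = 0" "\<gamma>' = 0" using * by simp_all
    have X: "X l \<beta> \<gamma> \<asymp> d j" "X l \<beta>' \<gamma>' \<asymp> d j" using s by (simp_all add: sol_def)
    have "\<beta> \<asymp> d 4" "\<beta>' \<asymp> d 4" using s by (simp_all add: sol_def)
    moreover have "cj (d 4) \<asymp> d 4"
      using trace_d_4 d_ne_0[OF r(3)] by (intro trace_eq_0_imp_sim) (simp_all add: add.commute)
    ultimately have b: "- cj \<beta> \<asymp> d 4" "- cj \<beta>' \<asymp> d 4"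
      using sim_trans sim_cj minus_sim by blast+
    have "\<not> d j \<asymp> d 4" using d_unique[of j 4] r assms by auto
    then have "- cj \<beta> = - cj \<beta>'"
      using sim_sum_unique(2)[OF X b] g by (simp add: X_def)
    then show ?thesis using g by simp
  qed
  then show ?thesis
    unfolding p_eq_card_sol[OF r] by (rule card_sol_1)
qed

section \<open>The unit conditions of the theorem\<close>

lemma unit_X_iff:
  assumes "i \<in> {4..q+4}"
  shows "d i * inverse x \<in> F0_units q \<longleftrightarrow> x \<asymp> d i"
  unfolding sim_iff_F0_units[symmetric] by (rule sim_sym)

text \<open>Multiplying \<open>d l * inverse (\<beta> * x)\<close> by the norm of
  \<open>\<beta> * x\<close> clears the inverse and yields \<open>cj \<beta> * d l * cj x\<close>.
  If \<open>\<beta> * x = 0\<close>, both sides fail.\<close>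

lemma unit_X'_iff:
  assumes "i \<in> {4..q+4}" "l \<in> {4..q+4}"
  shows "d i * \<beta> * inverse (d l) * x \<in> F0_units q \<longleftrightarrow> cj \<beta> * d l * cj x \<asymp> d i"
proof (cases "\<beta> * x = 0")
  case True
  then show ?thesis by (auto simp: sim_def F0_units_def)
next
  case False
  define n where "n = (\<beta> * x) * cj (\<beta> * x)"
  have n: "cj n = n" "n \<noteq> 0" using False by (auto simp: n_def mult_ac)
  have "d i * \<beta> * inverse (d l) * x = d i * inverse (d l * inverse (\<beta> * x))"
    using False by (simp add: field_simps)
  then have "d i * \<beta> * inverse (d l) * x \<in> F0_units q \<longleftrightarrow> d l * inverse (\<beta> * x) \<asymp> d i"
    by (simp only: unit_X_iff[OF assms(1)])
  also have "\<dots> \<longleftrightarrow> n * (d l * inverse (\<beta> * x)) \<asymp> d i" using n by simp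
  also have "n * (d l * inverse (\<beta> * x)) = cj \<beta> * d l * cj x"
    using False by (simp add: n_def field_simps)
  finally show ?thesis .
qed

lemma sol_4jk_iff:
  assumes "l \<in> {4..q+4}"
  shows "sol 4 j k l \<beta> \<gamma> \<longleftrightarrow> iso \<beta> \<gamma> \<and> \<beta> \<asymp> d k \<and> X l \<beta> \<gamma> \<asymp> d j \<and> d l * \<gamma> = \<beta> * c l"
proof -
  have r: "4 \<in> {4..q+4}" by simp
  have "cj \<beta> * d l * cj (X l \<beta> \<gamma>) \<asymp> d 4 \<longleftrightarrow> d l * \<gamma> = \<beta> * c l"
    if "iso \<beta> \<gamma>" "\<beta> \<asymp> d k" "X l \<beta> \<gamma> \<asymp> d j"
  proof -
    have "cj \<beta> * d l * cj (X l \<beta> \<gamma>) \<noteq> 0" using that d_ne_0[OF assms] by (auto simp: sim_def)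
    then show ?thesis
      using class_4_iff[OF r] trace_X'[OF assms that(1)] trace_eq_0_imp_sim trace_d_4 d_ne_0[OF r] by blast
  qed
  then show ?thesis unfolding sol_def by blast
qed

lemma sol_i4k_iff:
  assumes "l \<in> {4..q+4}"
  shows "sol i 4 k l \<beta> \<gamma> \<longleftrightarrow>
    iso \<beta> \<gamma> \<and> \<beta> \<asymp> d k \<and> cj \<beta> * d l * cj (X l \<beta> \<gamma>) \<asymp> d i \<and> \<gamma> = c l"
proof -
  have r: "4 \<in> {4..q+4}" by simp
  have "X l \<beta> \<gamma> \<asymp> d 4 \<longleftrightarrow> \<gamma> = c l"
    if "iso \<beta> \<gamma>" "cj \<beta> * d l * cj (X l \<beta> \<gamma>) \<asymp> d i"
  proof -
    have "X l \<beta> \<gamma> \<noteq> 0" using that by (auto simp: sim_def)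
    then show ?thesis
      using class_4_iff[OF r] trace_X[OF assms that(1)] trace_eq_0_imp_sim trace_d_4 d_ne_0[OF r] by blast
  qed
  then show ?thesis unfolding sol_def by blast
qed

text \<open>Trace zero leaves \<open>\<gamma> = 0\<close> as the only isotropic choice, so a single
  parameter suffices when the third index is 4.\<close>

lemma sol_ij4_iff:
  assumes "l \<in> {4..q+4}"
  shows "(\<exists>\<gamma>. sol i j 4 l \<beta> \<gamma>) \<longleftrightarrow> sol i j 4 l \<beta> 0"
proof -
  have "\<gamma> = 0" if "iso \<beta> \<gamma>" "\<beta> \<asymp> d 4" for \<gamma>
    using that class_4_iff[of 4 \<beta>] by (auto simp: iso_def)
  then show ?thesis unfolding sol_def by metis
qed

end

section \<open>Recovering the basis-dependent description\<close>

lemma mem_line_orbit_stab2_iff: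
  "S \<in> line_orbit (stab2 q P Q) T \<longleftrightarrow> (P, Q, S) \<in> orbit3 q (P, Q, T)"
  unfolding line_orbit_def stab2_def orbit3_def act3_def by simp metis

text \<open>Moving the third line while fixing \<open>P\<close> and \<open>Q\<close> amounts to
  moving the whole triple; this turns equality of \<open>H\<close>-orbits into a question about
  classes.\<close>

lemma line_orbit_stab2_eq_iff:
  "line_orbit (stab2 q P Q) S = line_orbit (stab2 q P Q) T \<longleftrightarrow>
     orbit3 q (P, Q, S) = orbit3 q (P, Q, T)"
proof
  assume *: "line_orbit (stab2 q P Q) S = line_orbit (stab2 q P Q) T"
  have "S \<in> line_orbit (stab2 q P Q) S"
    by (simp add: mem_line_orbit_stab2_iff orbit3_refl)
  then show "orbit3 q (P, Q, S) = orbit3 q (P, Q, T)"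
    unfolding * mem_line_orbit_stab2_iff by (rule orbit3_eq)
next
  assume "orbit3 q (P, Q, S) = orbit3 q (P, Q, T)"
  then show "line_orbit (stab2 q P Q) S = line_orbit (stab2 q P Q) T"
    by (intro set_eqI) (simp add: mem_line_orbit_stab2_iff)
qed

context quadratic_field
begin

text \<open>Vanishing of the trace is constant on a coset, so a coset not contained in the
  trace-zero set avoids it altogether. The representatives thus cover every class but one.\<close>

lemma coset_representatives:
  assumes bij: "bij_betw (\<lambda>i. F0_coset q (b i)) I
    {F0_coset q x | x. x \<noteq> 0 \<and> \<not> F0_coset q x \<subseteq> {y. y + bar q y = 0}}"
  shows "i \<in> I \<Longrightarrow> b i \<noteq> 0" and "i \<in> I \<Longrightarrow> b i + cj (b i) \<noteq> 0"
    and "i \<in> I \<Longrightarrow> j \<in> I \<Longrightarrow> b i \<asymp> b j \<Longrightarrow> i = j"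
    and "x \<noteq> 0 \<Longrightarrow> x + cj x \<noteq> 0 \<Longrightarrow> \<exists>i\<in>I. x \<asymp> b i"
proof -
  have *: "b i \<noteq> 0 \<and> b i + cj (b i) \<noteq> 0" if "i \<in> I" for i
  proof -
    obtain x where x: "F0_coset q (b i) = F0_coset q x" "x \<noteq> 0"
      "\<not> F0_coset q x \<subseteq> {y. y + bar q y = 0}"
      using bij_betwE[OF bij] \<open>i \<in> I\<close> by blast
    \<comment> \<open>The coset of 0 is {0}; the nonzero element \<open>x\<close> therefore rules
      out \<open>b i = 0\<close>.\<close>
    have "x \<in> F0_coset q x" using x(2) by (simp add: F0_coset_eq)
    then have nz: "b i \<noteq> 0" using x(1,2) by (auto simp: F0_coset_def)
    obtain y where "y \<asymp> b i" "y + cj y \<noteq> 0"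
      using x(3) unfolding x(1)[symmetric] F0_coset_eq[OF nz] cj_eq by blast
    then show ?thesis using nz trace_eq_0_sim by blast
  qed
  then show "i \<in> I \<Longrightarrow> b i \<noteq> 0" "i \<in> I \<Longrightarrow> b i + cj (b i) \<noteq> 0" by blast+
  show "i = j" if "i \<in> I" "j \<in> I" "b i \<asymp> b j"
    using bij_betw_imp_inj_on[OF bij] that * by (auto simp: inj_on_def F0_coset_eq_iff)
  show "\<exists>i\<in>I. x \<asymp> b i" if x: "x \<noteq> 0" "x + cj x \<noteq> 0"
  proof -
    have "x \<in> F0_coset q x" using x by (simp add: F0_coset_eq)
    then have "\<not> F0_coset q x \<subseteq> {y. y + bar q y = 0}" using x by (auto simp: cj_eq)
    then have "F0_coset q x \<in> (\<lambda>i. F0_coset q (b i)) ` I"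
      using x(1) unfolding bij_betw_imp_surj_on[OF bij] by blast
    then show ?thesis using x * F0_coset_eq_iff by blast
  qed
qed

end

context unitary_scheme
begin

text \<open>Conjugation preserves trace zero. This makes the mixed counts with superscripts 1, 2 and
  3 vanish.\<close>

lemma cj_d_sim_d_4:
  assumes "i \<in> {4..q+4}"
  shows "cj (d i) \<asymp> d 4 \<longleftrightarrow> i = 4" and "cj (d 4) \<asymp> d i \<longleftrightarrow> i = 4"
proof -
  have r: "4 \<in> {4..q+4}" by simp
  have 4: "cj (d 4) \<asymp> d 4"
    using trace_d_4 d_ne_0[OF r] by (intro trace_eq_0_imp_sim) (simp_all add: add.commute)
  show "cj (d 4) \<asymp> d i \<longleftrightarrow> i = 4"
    using 4 class_4_iff[OF assms, of "cj (d 4)"] trace_d_4 by (auto simp: add.commute)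
  have "i = 4" if "cj (d i) \<asymp> d 4"
  proof -
    have "d i + cj (d i) = 0" using that class_4_iff[OF r, of "cj (d i)"] by (simp add: add.commute)
    then show ?thesis using class_4_iff[OF assms, of "d i"] d_ne_0[OF assms] by simp
  qed
  then show "cj (d i) \<asymp> d 4 \<longleftrightarrow> i = 4" using 4 by blast
qed

lemma iso_cj: "i \<in> {4..q+4} \<Longrightarrow> iso (cj (d i)) (c i)"
  using d_iso[of i] by (simp add: iso_def add.commute)

text \<open>The relation is that of \<open>d i\<close> divided by its norm. The first point arises
  from \<open>pt (d i) (c i)\<close> by exchanging the first two coordinates and
  normalising.\<close>

lemma iso_inverse:
  assumes "i \<in> {4..q+4}"
  shows "iso (inverse (d i)) (inverse (d i) * c i)"
    and "iso (cj (inverse (d i))) (inverse (d i) * c i)"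
proof -
  have "d i \<noteq> 0" "cj (d i) \<noteq> 0" using d_ne_0[OF assms] by auto
  then have "inverse (d i) + cj (inverse (d i)) + inverse (d i) * c i * cj (inverse (d i) * c i) =
      (d i + cj (d i) + c i * cj (c i)) / (d i * cj (d i))"
    by (simp add: field_simps)
  then have *: "inverse (d i) + cj (inverse (d i)) + inverse (d i) * c i * cj (inverse (d i) * c i) = 0"
    using d_iso[OF assms] by (simp add: iso_def)
  then show "iso (inverse (d i)) (inverse (d i) * c i)" unfolding iso_def .
  show "iso (cj (inverse (d i))) (inverse (d i) * c i)"
    unfolding iso_def using * by (simp only: cj_cj add.commute)
qed

lemma p_1_orbit:
  assumes "i \<in> {5..q+4}" "j \<in> {5..q+4}"
  shows "p 1 j i 1 = (if R j = orbit3 q (E1, E2, pt (cj (d i)) (c i)) then q\<^sup>2 - 1 else 0)"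
proof -
  have r: "i \<in> {4..q+4}" "j \<in> {4..q+4}" "i \<noteq> 4" using assms by auto
  have "R j = orbit3 q (E1, E2, pt (cj (d i)) (c i)) \<longleftrightarrow> d j \<asymp> cj (d i)"
    unfolding R_orbit[OF r(2)]
    using r by (intro standard_orbit_eq_iff) (simp_all add: d_iso iso_cj d_ne_0)
  then show ?thesis using p_1[OF r(1,2)] r by (simp add: sim_sym[of "d j"])
qed

text \<open>As \<open>inverse (d i) \<asymp> cj (d i)\<close>, this is the same orbit as in
  \<open>p_1_orbit\<close>, written with another representative.\<close>

lemma p_2_orbit:
  assumes "i \<in> {5..q+4}" "j \<in> {5..q+4}"
  shows "p j 2 i 2 = (if R j = orbit3 q (E1, E2, pt (inverse (d i)) (inverse (d i) * c i))
    then q\<^sup>2 - 1 else 0)"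
proof -
  have r: "i \<in> {4..q+4}" "j \<in> {4..q+4}" "i \<noteq> 4" using assms by auto
  have "R j = orbit3 q (E1, E2, pt (inverse (d i)) (inverse (d i) * c i)) \<longleftrightarrow> d j \<asymp> inverse (d i)"
    unfolding R_orbit[OF r(2)]
    using r by (intro standard_orbit_eq_iff iso_inverse) (simp_all add: d_iso d_ne_0)
  then show ?thesis
    using p_2[OF r(1,2)] r by (simp add: sim_sym[of "d j"] inverse_sim d_ne_0)
qed

lemma p_3_orbit:
  assumes "i \<in> {5..q+4}" "j \<in> {5..q+4}"
  shows "p j i 3 3 = (if orbit3 q (E1, E2, pt (cj (d i)) (c i)) =
      orbit3 q (E1, E2, pt (cj (inverse (d j))) (inverse (d j) * c j)) then q\<^sup>2 - 1 else 0)"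
proof -
  have r: "i \<in> {4..q+4}" "j \<in> {4..q+4}" "j \<noteq> 4" using assms by auto
  have "orbit3 q (E1, E2, pt (cj (d i)) (c i)) =
      orbit3 q (E1, E2, pt (cj (inverse (d j))) (inverse (d j) * c j)) \<longleftrightarrow>
      cj (d i) \<asymp> cj (inverse (d j))"
    using r by (intro standard_orbit_eq_iff iso_inverse iso_cj) (simp_all add: d_ne_0)
  also have "\<dots> \<longleftrightarrow> cj (d j) \<asymp> d i"
    using d_ne_0[OF r(2)] unfolding sim_cj by (simp add: sim_sym[of "d i"] inverse_sim)
  finally show ?thesis using p_3[OF r(1,2)] r by simp
qed

lemma sol_iff_units:
  assumes "i \<in> {4..q+4}" "j \<in> {4..q+4}" "l \<in> {4..q+4}"
  shows "sol i j k l \<beta> \<gamma> \<longleftrightarrow> iso \<beta> \<gamma> \<and> \<beta> \<asymp> d k \<and>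
    d i * \<beta> * inverse (d l) * (cj \<beta> + d l + cj \<gamma> * c l) \<in> F0_units q \<and>
    d j * inverse (cj \<beta> + d l + cj \<gamma> * c l) \<in> F0_units q"
  unfolding sol_def unit_X_iff[OF assms(2)] unit_X'_iff[OF assms(1,3)] X_def by blast

end

theorem theorem3p5:
  fixes q :: nat
    and u v w :: "'a::{field, finite} ^ 3"
    and a :: 'a
    and b c :: "nat \<Rightarrow> 'a"
    and R :: "nat \<Rightarrow> (('a ^ 3) set \<times> ('a ^ 3) set \<times> ('a ^ 3) set) set"
    and p :: "nat \<Rightarrow> nat \<Rightarrow> nat \<Rightarrow> nat \<Rightarrow> nat"
    and H :: "('a ^ 3 \<Rightarrow> 'a ^ 3) set"
  assumes q: "primepow q"
    and F: "CARD('a) = q ^ 2"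
    and basis: "distinct [u, v, w]" "vec.independent {u, v, w}" "vec.span {u, v, w} = UNIV"
    and form: "herm q u v = 1" "herm q w w = 1" "herm q u u = 0" "herm q v v = 0"
      "herm q u w = 0" "herm q v w = 0"
    and a: "a \<noteq> 0" "a + bar q a = 0"
    and b: "bij_betw (\<lambda>i. F0_coset q (b i)) {5..q+4}
              {F0_coset q x | x. x \<noteq> 0 \<and> \<not> F0_coset q x \<subseteq> {y. y + bar q y = 0}}"
    and c: "\<forall>i\<in>{5..q+4}. b i + bar q (b i) + c i * bar q (c i) = 0"
    and R0: "R 0 = {(x, x, x) | x. x \<in> PC q}"
    and R1: "R 1 = {(y, x, x) | x y. x \<in> PC q \<and> y \<in> PC q \<and> x \<noteq> y}"
    and R2: "R 2 = {(x, y, x) | x y. x \<in> PC q \<and> y \<in> PC q \<and> x \<noteq> y}"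
    and R3: "R 3 = {(x, x, y) | x y. x \<in> PC q \<and> y \<in> PC q \<and> x \<noteq> y}"
    and R4: "R 4 = orbit3 q (line u, line v, line (a *s u + v))"
    and Ri: "\<forall>i\<in>{5..q+4}. R i = orbit3 q (line u, line v, line (b i *s u + v + c i *s w))"
    and p: "p = inum (PC q) R"
    and H: "H = stab2 q (line u) (line v)"
  shows
    \<comment> \<open>\<open>p i j k l\<close> is $p_{ijk}^{l}$\<close>
    "{orbit3 q T | T. T \<in> PC q \<times> PC q \<times> PC q} = R ` {0..q+4} \<and>
     AST (PC q) (q + 4) R \<and>
     (\<forall>i\<in>{5..q+4}. \<forall>j\<in>{5..q+4}. \<forall>k\<in>{5..q+4}. \<forall>l\<in>{5..q+4}.
       \<comment> \<open>1\<close>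
       (p 1 4 4 1 = q - 1 \<and> p 4 2 4 2 = q - 1 \<and> p 4 4 3 3 = q - 1) \<and>
       \<comment> \<open>2\<close>
       (p 1 4 i 1 = 0 \<and> p 1 i 4 1 = 0 \<and> p 4 2 i 2 = 0 \<and> p i 2 4 2 = 0 \<and>
        p 4 i 3 3 = 0 \<and> p i 4 3 3 = 0) \<and>
       \<comment> \<open>3\<close>
       p 1 j i 1 =
         (if R j = orbit3 q (line u, line v, line (bar q (b i) *s u + v + c i *s w))
          then q ^ 2 - 1 else 0) \<and>
       \<comment> \<open>4\<close>
       p j 2 i 2 =
         (if R j = orbit3 q (line u, line v,
                     line (inverse (b i) *s u + v + (inverse (b i) * c i) *s w))
          then q ^ 2 - 1 else 0) \<and>
       \<comment> \<open>5\<close>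
       p j i 3 3 =
         (if line_orbit H (line (bar q (b i) *s u + v + c i *s w)) =
             line_orbit H (line (bar q (inverse (b j)) *s u + v + (inverse (b j) * c j) *s w))
          then q ^ 2 - 1 else 0) \<and>
       \<comment> \<open>6\<close>
       p 4 4 4 4 = q - 2 \<and>
       \<comment> \<open>7\<close>
       (p i 4 4 4 = 0 \<and> p 4 j 4 4 = 0 \<and> p 4 4 k 4 = 0 \<and>
        p i j 4 4 = 0 \<and> p i 4 k 4 = 0 \<and> p 4 j k 4 = 0) \<and>
       \<comment> \<open>8\<close>
       p i j k 4 =
         (if \<exists>\<beta> \<gamma>. (line u, line v, line (\<beta> *s u + v + \<gamma> *s w)) \<in> R k \<and>
               b j * inverse (bar q \<beta> + a) \<in> F0_units q \<and>
               b i * \<beta> * (bar q \<beta> + a) * inverse a \<in> F0_units q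
          then q + 1 else 0) \<and>
       \<comment> \<open>9\<close>
       (p i 4 4 l = 0 \<and> p 4 j 4 l = 0 \<and> p 4 4 k l = 0 \<and> p 4 4 4 l = 0) \<and>
       \<comment> \<open>10\<close>
       p 4 j k l =
         (if \<exists>\<beta> \<gamma>. (line u, line v, line (\<beta> *s u + v + \<gamma> *s w)) \<in> R k \<and>
               b j * inverse (bar q \<beta> + b l + bar q \<gamma> * c l) \<in> F0_units q \<and>
               b l * \<gamma> = \<beta> * c l
          then 1 else 0) \<and>
       \<comment> \<open>11\<close>
       p i 4 k l =
         (if \<exists>\<beta> \<gamma>. (line u, line v, line (\<beta> *s u + v + \<gamma> *s w)) \<in> R k \<and>
               b i * \<beta> * inverse (b l) * (bar q \<beta> + b l + bar q \<gamma> * c l) \<in> F0_units q \<and>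
               \<gamma> = c l
          then 1 else 0) \<and>
       \<comment> \<open>12\<close>
       p i j 4 l =
         (if \<exists>g. (line u, line v, line (g *s u + v)) \<in> R 4 \<and>
               b i * (bar q g + b l) * g * inverse (b l) \<in> F0_units q \<and>
               b j * inverse (bar q g + b l) \<in> F0_units q
          then 1 else 0) \<and>
       \<comment> \<open>13\<close>
       p i j k l =
         card {(line u, line v, line (\<beta> *s u + v + \<gamma> *s w)) | \<beta> \<gamma>.
               (line u, line v, line (\<beta> *s u + v + \<gamma> *s w)) \<in> R k \<and>
               b i * \<beta> * inverse (b l) * (bar q \<beta> + b l + bar q \<gamma> * c l) \<in> F0_units q \<and>
               b j * inverse (bar q \<beta> + b l + bar q \<gamma> * c l) \<in> F0_units q})"
proof -
  define cj where "cj = (\<lambda>x::'a. x ^ q)"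
  interpret quadratic_field q cj
    by unfold_locales (use q F in \<open>simp_all add: cj_def\<close>)
  \<comment> \<open>The vector \<open>a *s u + v\<close> defining \<open>R 4\<close> has coordinates
    (a, 1, 0), which explains the values at index 4.\<close>
  define d where "d = b(4 := a)"
  define c' where "c' = c(4 := 0)"
  have d4: "d 4 = a" "c' 4 = 0" by (simp_all add: d_def c'_def)
  have d5: "d i = b i" "c' i = c i" if "i \<in> {5..q+4}" for i
    using that by (auto simp: d_def c'_def)
  \<comment> \<open>The isometry taking the standard basis to \<open>u\<close>, \<open>v\<close>,
    \<open>w\<close>. Orbits do not change under it, which reduces the claim to standard
    coordinates.\<close>
  define \<sigma> where "\<sigma> = combine u v w"
  have \<sigma>: "\<sigma> \<in> U3 q"
    unfolding \<sigma>_def using form by (intro combine_in_U3) (simp add: hyperbolic_basis_def)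
  have frame: "line u = \<sigma> ` E1" "line v = \<sigma> ` E2"
      "line (\<beta> *s u + v + \<gamma> *s w) = \<sigma> ` pt \<beta> \<gamma>" "line (\<beta> *s u + v) = \<sigma> ` pt \<beta> 0" for \<beta> \<gamma>
    unfolding E1_def pt_def U3_image_line[OF \<sigma>] by (simp_all add: \<sigma>_def combine_def)
  have orbit: "orbit3 q (\<sigma> ` P, \<sigma> ` Q, \<sigma> ` S) = orbit3 q (P, Q, S)" for P Q S
    using orbit3_act[OF \<sigma>, of "(P, Q, S)"] by (simp add: act3_def)
  note rep = coset_representatives[OF b]
  have trace_a: "a + cj a = 0" using a by (simp add: cj_def)
  have cases_4: "i = 4 \<or> i \<in> {5..q+4}" if "i \<in> {4..q+4}" for i using that by auto
  interpret unitary_scheme q cj d c' R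
  proof
    show "d i \<noteq> 0" if "i \<in> {4..q+4}" for i
      using cases_4[OF that] a rep(1)[of i] d4 d5 by auto
    show "iso (d i) (c' i)" if "i \<in> {4..q+4}" for i
      using cases_4[OF that]
    proof
      assume "i = 4" then show ?thesis using trace_a d4 by (simp add: iso_def)
    next
      assume "i \<in> {5..q+4}" then show ?thesis using c d5[of i] by (simp add: iso_def) (simp add: cj_eq)
    qed
    show "i = j" if ij: "i \<in> {4..q+4}" "j \<in> {4..q+4}" "sim (d i) (d j)" for i j
    proof -
      \<comment> \<open>Only index 4 has trace zero, so an equivalence cannot mix it with the
        others, for which \<open>rep(3)\<close> decides.\<close>
      have "i = 4 \<longleftrightarrow> d i + cj (d i) = 0" if "i \<in> {4..q+4}" for i
        using cases_4[OF that] rep(2)[of i] d4 d5[of i] trace_a by auto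
      then have "i = 4 \<longleftrightarrow> j = 4" using ij trace_eq_0_sim by blast
      then show ?thesis using cases_4[OF ij(1)] cases_4[OF ij(2)] rep(3)[of i j] ij(3) d5 by auto
    qed
    show "\<exists>i\<in>{4..q+4}. sim x (d i)" if x: "x \<noteq> 0" for x
    proof (cases "x + cj x = 0")
      case True
      then have "sim x (d 4)" using x trace_a a d4 by (simp add: trace_eq_0_imp_sim)
      then show ?thesis by (intro bexI[of _ 4]) auto
    next
      case False
      then obtain i where "i \<in> {5..q+4}" "sim x (b i)" using rep(4)[OF x] by blast
      then show ?thesis using d5(1)[of i] by (intro bexI[of _ i]) auto
    qed
    show "R i = orbit3 q (E1, E2, pt (d i) (c' i))" if "i \<in> {4..q+4}" for i
      using cases_4[OF that]
    proof
      assume "i = 4"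
      then show ?thesis using R4 d4 by (simp add: frame orbit)
    next
      assume "i \<in> {5..q+4}"
      then show ?thesis using Ri d5[of i] by (simp add: frame orbit)
    qed
  qed (rule d4 R0 R1 R2 R3)+
  have mem: "(\<sigma> ` E1, \<sigma> ` E2, \<sigma> ` pt \<beta> \<gamma>) \<in> R k \<longleftrightarrow> iso \<beta> \<gamma> \<and> sim \<beta> (d k)" if "k \<in> {4..q+4}" for k \<beta> \<gamma>
    using act3_mem_R_iff[OF \<sigma> range_4_0[OF that]] R_standard_iff[OF that] by simp
  have r4: "4 \<in> {4..q+4}" by simp
  have H_orbit: "line_orbit H (\<sigma> ` P) = line_orbit H (\<sigma> ` Q) \<longleftrightarrow>
      orbit3 q (E1, E2, P) = orbit3 q (E1, E2, Q)" for P Q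
    unfolding H frame line_orbit_stab2_eq_iff orbit ..
  show ?thesis
    unfolding p frame cj_eq[symmetric] H_orbit orbit
  proof (intro conjI ballI)
    show "{orbit3 q T | T. T \<in> PC q \<times> PC q \<times> PC q} = R ` {0..q+4}" by (rule orbits_eq)
    show "AST (PC q) (q + 4) R" by (rule is_AST)
    fix i j k l assume ijkl: "i \<in> {5..q+4}" "j \<in> {5..q+4}" "k \<in> {5..q+4}" "l \<in> {5..q+4}"
    then have r: "i \<in> {4..q+4}" "j \<in> {4..q+4}" "k \<in> {4..q+4}" "l \<in> {4..q+4}"
      and ne: "i \<noteq> 4" "j \<noteq> 4" "k \<noteq> 4" "l \<noteq> 4" by auto
    note e = d5[OF ijkl(1), symmetric] d5[OF ijkl(2), symmetric] d5[OF ijkl(3), symmetric]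
      d5[OF ijkl(4), symmetric] d4(1)[symmetric]
    show "inum (PC q) R 1 4 4 1 = q - 1" "inum (PC q) R 4 2 4 2 = q - 1" "inum (PC q) R 4 4 3 3 = q - 1"
      using p_1[OF r4 r4] p_2[OF r4 r4] p_3[OF r4 r4] cj_d_sim_d_4(1)[OF r4] by simp_all
    show "inum (PC q) R 1 4 i 1 = 0" "inum (PC q) R 1 i 4 1 = 0" "inum (PC q) R 4 2 i 2 = 0"
      "inum (PC q) R i 2 4 2 = 0" "inum (PC q) R 4 i 3 3 = 0" "inum (PC q) R i 4 3 3 = 0"
      using p_1[OF r(1) r4] p_1[OF r4 r(1)] p_2[OF r(1) r4] p_2[OF r4 r(1)]
        p_3[OF r(1) r4] p_3[OF r4 r(1)] cj_d_sim_d_4[OF r(1)] ne by simp_all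
    show "inum (PC q) R 1 j i 1 = (if R j = orbit3 q (E1, E2, pt (cj (b i)) (c i)) then q ^ 2 - 1 else 0)"
      unfolding e by (rule p_1_orbit[OF ijkl(1,2)])
    show "inum (PC q) R j 2 i 2 =
        (if R j = orbit3 q (E1, E2, pt (inverse (b i)) (inverse (b i) * c i)) then q ^ 2 - 1 else 0)"
      unfolding e by (rule p_2_orbit[OF ijkl(1,2)])
    show "inum (PC q) R j i 3 3 = (if orbit3 q (E1, E2, pt (cj (b i)) (c i)) =
        orbit3 q (E1, E2, pt (cj (inverse (b j))) (inverse (b j) * c j)) then q ^ 2 - 1 else 0)"
      unfolding e by (rule p_3_orbit[OF ijkl(1,2)])
    show "inum (PC q) R 4 4 4 4 = q - 2" by (rule p_444_4)
    have zero: "inum (PC q) R i' j' k' l' = 0"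
      if "\<And>\<beta> \<gamma>. \<not> sol i' j' k' l' \<beta> \<gamma>" "i' \<in> {4..q+4}" "j' \<in> {4..q+4}" "k' \<in> {4..q+4}" "l' \<in> {4..q+4}"
      for i' j' k' l'
      using p_eq_card_sol[OF that(2-5)] that(1) by simp
    show "inum (PC q) R i 4 4 4 = 0" "inum (PC q) R 4 j 4 4 = 0" "inum (PC q) R 4 4 k 4 = 0"
      "inum (PC q) R i j 4 4 = 0" "inum (PC q) R i 4 k 4 = 0" "inum (PC q) R 4 j k 4 = 0"
      by (rule zero; (rule r r4)?; use sol_superscript_4 r r4 ne in blast)+
    show "inum (PC q) R i j k 4 = (if \<exists>\<beta> \<gamma>. (\<sigma> ` E1, \<sigma> ` E2, \<sigma> ` pt \<beta> \<gamma>) \<in> R k \<and>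
        b j * inverse (cj \<beta> + a) \<in> F0_units q \<and> b i * \<beta> * (cj \<beta> + a) * inverse a \<in> F0_units q
        then q + 1 else 0)"
    proof -
      have "(\<sigma> ` E1, \<sigma> ` E2, \<sigma> ` pt \<beta> \<gamma>) \<in> R k \<and> b j * inverse (cj \<beta> + a) \<in> F0_units q \<and>
          b i * \<beta> * (cj \<beta> + a) * inverse a \<in> F0_units q \<longleftrightarrow> sol i j k 4 \<beta> \<gamma>" for \<beta> \<gamma>
        unfolding sol_iff_units[OF r(1,2) r4] mem[OF r(3)] e
        by (auto simp: d4(2) mult_ac)
      then show ?thesis using p_ijk_4[OF ijkl(1-3)] by simp
    qed
    show "inum (PC q) R i 4 4 l = 0" "inum (PC q) R 4 j 4 l = 0" "inum (PC q) R 4 4 k l = 0"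
      "inum (PC q) R 4 4 4 l = 0"
      by (rule zero; (rule r r4)?; use sol_two_4 r r4 ijkl(4) in blast)+
    show "inum (PC q) R 4 j k l = (if \<exists>\<beta> \<gamma>. (\<sigma> ` E1, \<sigma> ` E2, \<sigma> ` pt \<beta> \<gamma>) \<in> R k \<and>
        b j * inverse (cj \<beta> + b l + cj \<gamma> * c l) \<in> F0_units q \<and> b l * \<gamma> = \<beta> * c l then 1 else 0)"
    proof -
      have "(\<sigma> ` E1, \<sigma> ` E2, \<sigma> ` pt \<beta> \<gamma>) \<in> R k \<and>
          b j * inverse (cj \<beta> + b l + cj \<gamma> * c l) \<in> F0_units q \<and> b l * \<gamma> = \<beta> * c l \<longleftrightarrow>
          sol 4 j k l \<beta> \<gamma>" for \<beta> \<gamma>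
        unfolding sol_4jk_iff[OF r(4)] mem[OF r(3)] e unit_X_iff[OF r(2)] X_def by blast
      then show ?thesis using p_4jk[OF ijkl(2-4)] by simp
    qed
    show "inum (PC q) R i 4 k l = (if \<exists>\<beta> \<gamma>. (\<sigma> ` E1, \<sigma> ` E2, \<sigma> ` pt \<beta> \<gamma>) \<in> R k \<and>
        b i * \<beta> * inverse (b l) * (cj \<beta> + b l + cj \<gamma> * c l) \<in> F0_units q \<and> \<gamma> = c l then 1 else 0)"
    proof -
      have "(\<sigma> ` E1, \<sigma> ` E2, \<sigma> ` pt \<beta> \<gamma>) \<in> R k \<and>
          b i * \<beta> * inverse (b l) * (cj \<beta> + b l + cj \<gamma> * c l) \<in> F0_units q \<and> \<gamma> = c l \<longleftrightarrow>
          sol i 4 k l \<beta> \<gamma>" for \<beta> \<gamma>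
        unfolding sol_i4k_iff[OF r(4)] mem[OF r(3)] e unit_X'_iff[OF r(1,4)] X_def by blast
      then show ?thesis using p_i4k[OF ijkl(1,3,4)] by simp
    qed
    show "inum (PC q) R i j 4 l = (if \<exists>g. (\<sigma> ` E1, \<sigma> ` E2, \<sigma> ` pt g 0) \<in> R 4 \<and>
        b i * (cj g + b l) * g * inverse (b l) \<in> F0_units q \<and>
        b j * inverse (cj g + b l) \<in> F0_units q then 1 else 0)"
    proof -
      have "(\<sigma> ` E1, \<sigma> ` E2, \<sigma> ` pt g 0) \<in> R 4 \<and>
          b i * (cj g + b l) * g * inverse (b l) \<in> F0_units q \<and>
          b j * inverse (cj g + b l) \<in> F0_units q \<longleftrightarrow> sol i j 4 l g 0" for g
        unfolding sol_iff_units[OF r(1,2,4)] mem[OF r4] e by (auto simp: mult_ac)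
      then show ?thesis using p_ij4[OF ijkl(1,2,4)] by (simp add: sol_ij4_iff[OF r(4)])
    qed
    show "inum (PC q) R i j k l = card {(\<sigma> ` E1, \<sigma> ` E2, \<sigma> ` pt \<beta> \<gamma>) | \<beta> \<gamma>.
        (\<sigma> ` E1, \<sigma> ` E2, \<sigma> ` pt \<beta> \<gamma>) \<in> R k \<and>
        b i * \<beta> * inverse (b l) * (cj \<beta> + b l + cj \<gamma> * c l) \<in> F0_units q \<and>
        b j * inverse (cj \<beta> + b l + cj \<gamma> * c l) \<in> F0_units q}"
    proof -
      have pairs: "{f x y | x y. P x y} = (\<lambda>(x, y). f x y) ` {(x, y). P x y}"
        for f :: "'a \<Rightarrow> 'a \<Rightarrow> ('a ^ 3) set \<times> ('a ^ 3) set \<times> ('a ^ 3) set" and P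
        by auto
      have sol: "(\<sigma> ` E1, \<sigma> ` E2, \<sigma> ` pt \<beta> \<gamma>) \<in> R k \<and>
          b i * \<beta> * inverse (b l) * (cj \<beta> + b l + cj \<gamma> * c l) \<in> F0_units q \<and>
          b j * inverse (cj \<beta> + b l + cj \<gamma> * c l) \<in> F0_units q \<longleftrightarrow> sol i j k l \<beta> \<gamma>" for \<beta> \<gamma>
        unfolding sol_iff_units[OF r(1,2,4)] mem[OF r(3)] e by blast
      \<comment> \<open>The theorem counts triples of lines, \<open>sol\<close> counts pairs of
        coordinates; distinct pairs give distinct third lines.\<close>
      have "inj_on (\<lambda>(\<beta>, \<gamma>). (\<sigma> ` E1, \<sigma> ` E2, \<sigma> ` pt \<beta> \<gamma>)) {(\<beta>, \<gamma>). sol i j k l \<beta> \<gamma>}"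
        by (rule inj_onI) (clarsimp simp: U3_image_eq_iff[OF \<sigma>])
      then show ?thesis unfolding sol pairs by (simp add: p_eq_card_sol[OF r] card_image)
    qed
  qed
qed

end
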